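(* Let $q\geq 7$ be a power of an odd prime. There is a function $\omega:\mathbb{N}\to\mathbb{R}$ with $\omega(n)\to\infty$ as $n\to\infty$ such that every $[n,k,6]_q$ code satisfies \[ k\leq n - 2\log_q n - \omega(n). \]
   Context: An $[n,k,d]_q$ code is a $k$-dimensional linear subspace $\mathcal{C}$ of $\mathbb{F}_q^n$ whose minimum distance is $d$, i.e. the minimum Hamming distance between two distinct codewords (equivalently the minimum number of nonzero entries of a nonzero codeword) equals $d$. *)

theory Defs
  imports "HOL-Library.Cardinality" "Jordan_Normal_Form.VS_Connect"
begin

definition hamming_dist :: "'a vec \<Rightarrow> 'a vec \<Rightarrow> nat" where
  "hamming_dist x y = card {i. i < dim_vec x \<and> x $ i \<noteq> y $ i}"

text \<open>A code with at most one word has no minimum distance, so the relation below holds for no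
  \<open>d\<close> in that case; in particular the zero subspace is not an \<open>[n,0,d]\<close> code for any \<open>d\<close>.\<close>

definition has_min_distance :: "'a vec set \<Rightarrow> nat \<Rightarrow> bool" where
  "has_min_distance C d \<longleftrightarrow>
     (\<exists>x\<in>C. \<exists>y\<in>C. x \<noteq> y \<and> hamming_dist x y = d) \<and>
     (\<forall>x\<in>C. \<forall>y\<in>C. x \<noteq> y \<longrightarrow> d \<le> hamming_dist x y)"

text \<open>The ambient field is the type \<open>'a\<close>, so that \<open>q = CARD('a)\<close>.\<close>

definition linear_code :: "nat \<Rightarrow> nat \<Rightarrow> nat \<Rightarrow> 'a::{field,finite} vec set \<Rightarrow> bool" where
  "linear_code n k d C \<longleftrightarrow>
     VectorSpace.subspace class_ring C (module_vec TYPE('a) n) \<and>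
     vectorspace.dim class_ring ((module_vec TYPE('a) n)\<lparr>carrier := C\<rparr>) = k \<and>
     has_min_distance C d"

end

theory Submission
  imports Defs "HOL-Library.Function_Algebras" "HOL-Library.Indicator_Function" "HOL-Analysis.L2_Norm"
begin

text \<open>
  Let \<open>r = n - k\<close>, \<open>N = q\<^sup>r\<close>, and let \<open>A\<close> be the set of the \<open>n\<close> columns of a parity check matrix,
  of which any five are linearly independent. It suffices to show \<open>n = o(N\<^bsup>1/2\<^esup>)\<close>.
  Choose five nonzero coefficients \<open>\<alpha>\<^sub>i\<close> with sum \<open>0\<close> and no proper vanishing subsum. Then
  \<open>\<alpha>\<^sub>0x\<^sub>0 + \<dots> + \<alpha>\<^sub>4x\<^sub>4 = 0\<close> has only the \<open>n\<close> constant solutions in \<open>A\<close>. Since \<open>A\<close> is a Sidon set, the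
  fourth powers of its Fourier coefficients add up to at most \<open>2n\<^sup>2N\<close>. If \<open>n\<^sup>2 \<ge> \<epsilon>N\<close>, then only
  boundedly many coefficients exceed \<open>\<delta>n\<close>; let \<open>W\<close> be their annihilator, and replace \<open>A\<close> by the
  function counting its points in each coset of \<open>W\<close>. This changes the suitably normalized number of
  solutions by at most \<open>10\<delta>n\<^sup>3\<close>. The Sidon property bounds the second moment of the new function,
  which is therefore at least half its mean on a set of density at least \<open>\<epsilon>/8\<close>. A dense set
  contains a positive proportion of all solutions, by a density increment on hyperplanes, and this
  forces a number of solutions of order \<open>n\<^sup>3\<close>, more than the \<open>n\<close> constant ones.
\<close>

section \<open>Additive characters of finite fields\<close>

lemma exists_nontrivial_additive_character:
  "\<exists>\<chi> :: 'a::{field,finite} \<Rightarrow> complex.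
     (\<forall>x y. \<chi> (x + y) = \<chi> x * \<chi> y) \<and> (\<forall>x. norm (\<chi> x) = 1) \<and> (\<exists>x. \<chi> x \<noteq> 1)"
proof -
  define p where "p = int CHAR('a)"
  have CHAR_pos: "CHAR('a) > 0"
    by (rule finite_imp_CHAR_pos) simp
  then have "prime CHAR('a)"
    by (rule prime_CHAR_semidom)
  then have p: "prime p"
    unfolding p_def by simp
  have of_int_p: "of_int j = (0::'a) \<longleftrightarrow> p dvd j" for j
    unfolding p_def by (rule of_int_eq_0_iff_char_dvd)
  have inverse_mod: "\<exists>l. of_int j * of_int l = (1::'a)" if "\<not> p dvd j" for j
  proof -
    have "coprime j p"
      using p that by (metis prime_imp_coprime coprime_commute)
    then obtain l m where "l * j + m * p = 1"
      by (metis bezout_int coprime_iff_gcd_eq_1)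
    then have "p dvd j * l - 1"
      by (intro dvdI[of _ _ "- m"]) (simp add: algebra_simps)
    then have "of_int (j * l - 1) = (0::'a)"
      unfolding of_int_p .
    then show ?thesis by (intro exI[of _ l]) simp
  qed
  (* A maximal additive subgroup G without 1 is a complement of the prime field, so the character
     of the prime field extends trivially along G. *)
  define sg where "sg G \<longleftrightarrow> (0::'a) \<in> G \<and> (\<forall>x\<in>G. \<forall>y\<in>G. x - y \<in> G)" for G
  have "{0} \<in> {G. sg G \<and> 1 \<notin> G}" unfolding sg_def by simp
  then obtain G where G: "sg G" "1 \<notin> G"
    and G_max: "\<And>G'. sg G' \<Longrightarrow> 1 \<notin> G' \<Longrightarrow> G \<subseteq> G' \<Longrightarrow> G' = G"
    using finite_has_maximal2[of "{G. sg G \<and> 1 \<notin> G}" "{0}"] by auto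
  have G0: "0 \<in> G" and Gdiff: "\<And>x y. x \<in> G \<Longrightarrow> y \<in> G \<Longrightarrow> x - y \<in> G"
    using G(1) unfolding sg_def by auto
  have Gneg: "- x \<in> G" if "x \<in> G" for x
    using Gdiff[OF G0 that] by simp
  have Gadd: "x + y \<in> G" if "x \<in> G" "y \<in> G" for x y
    using Gdiff[OF that(1) Gneg[OF that(2)]] by simp
  have Gnat: "of_nat k * x \<in> G" if "x \<in> G" for k x
    by (induction k) (simp_all add: G0 Gadd that distrib_right)
  have Gint: "of_int k * x \<in> G" if "x \<in> G" for k x
    using Gnat[OF that, of "nat k"] Gneg[OF Gnat[OF that, of "nat (- k)"]]
    by (cases "k \<ge> 0") simp_all
  have in_G: "p dvd k" if "of_int k \<in> G" for k
  proof (rule ccontr)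
    assume "\<not> p dvd k"
    then obtain l where "of_int k * of_int l = (1::'a)"
      using inverse_mod by blast
    with Gint[OF that, of l] G(2) show False by (simp add: mult.commute)
  qed
  have cover: "\<exists>k. x - of_int k \<in> G" for x
  proof (cases "x \<in> G")
    case True
    then show ?thesis by (intro exI[of _ 0]) simp
  next
    case False
    \<comment> \<open>\<open>G'\<close> is the subgroup generated by \<open>G\<close> and
      \<open>x\<close>. By maximality it contains \<open>1\<close>; the coefficient of
      \<open>x\<close> in such an expression of \<open>1\<close> is invertible modulo
      \<open>p\<close>, so \<open>x\<close> lies in the prime field plus \<open>G\<close>.\<close>
    define G' where "G' = {g + of_int j * x | g j. g \<in> G}"
    have "sg G'"
      unfolding sg_def
    proof (intro conjI ballI)
      show "0 \<in> G'" unfolding G'_def using G0 by (auto intro!: exI[of _ 0])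
      fix y z assume "y \<in> G'" "z \<in> G'"
      then obtain g j h i where "y = g + of_int j * x" "z = h + of_int i * x" "g \<in> G" "h \<in> G"
        unfolding G'_def by auto
      then have "y - z = (g - h) + of_int (j - i) * x" "g - h \<in> G"
        using Gdiff by (auto simp: algebra_simps)
      then show "y - z \<in> G'" unfolding G'_def by blast
    qed
    moreover have "G \<subseteq> G'"
    proof
      fix g assume "g \<in> G"
      then show "g \<in> G'" unfolding G'_def by (intro CollectI exI[of _ g] exI[of _ 0]) simp
    qed
    moreover have "x \<in> G'"
      unfolding G'_def using G0 by (intro CollectI exI[of _ 0] exI[of _ 1]) simp
    ultimately have "1 \<in> G'" using G_max False by blast
    then obtain g j where gj: "1 = g + of_int j * x" "g \<in> G"
      unfolding G'_def by auto
    have "\<not> p dvd j"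
    proof
      assume "p dvd j"
      then have "of_int j = (0::'a)" by (simp add: of_int_p)
      with gj G(2) show False by simp
    qed
    then obtain l where l: "of_int j * of_int l = (1::'a)"
      using inverse_mod by blast
    have "x - of_int l = x - of_int l * (g + of_int j * x)"
      using gj(1) by simp
    also have "\<dots> = x - (of_int j * of_int l) * x - of_int l * g"
      by (simp add: algebra_simps)
    also have "\<dots> = - (of_int l * g)"
      unfolding l by simp
    finally have "x - of_int l \<in> G"
      using Gneg[OF Gint[OF gj(2)]] by simp
    then show ?thesis by blast
  qed
  \<comment> \<open>The standard character of the integers modulo \<open>p\<close>.\<close>
  define e where "e k = cis (2 * pi * (of_int k / of_int p))" for k
  have p0: "p > 0" using p prime_gt_0_int by blast
  have e_add: "e (k + l) = e k * e l" for k l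
    unfolding e_def by (simp add: cis_mult add_divide_distrib distrib_left)
  have e_dvd: "e k = 1" if k: "p dvd k" for k
  proof -
    obtain c where "k = p * c" using k by (rule dvdE)
    then have "e k = cis (2 * pi * of_int c)"
      unfolding e_def using p0 by simp
    then show ?thesis by (simp add: cis_multiple_2pi)
  qed
  \<comment> \<open>The integer \<open>k\<close> is unique up to multiples of \<open>p\<close> by
    \<open>in_G\<close>, and \<open>e\<close> has period \<open>p\<close>, so the value does not
    depend on the choice.\<close>
  define \<chi> where "\<chi> x = e (SOME k. x - of_int k \<in> G)" for x :: 'a
  have chi: "\<chi> x = e k" if "x - of_int k \<in> G" for x k
  proof -
    define l where "l = (SOME k. x - of_int k \<in> G)"
    have "x - of_int l \<in> G"
      unfolding l_def using that by (rule someI)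
    from Gdiff[OF that this] have "of_int (l - k) \<in> G" by simp
    then have "p dvd l - k" by (rule in_G)
    then have "e (k + (l - k)) = e k"
      unfolding e_add by (simp add: e_dvd)
    then show ?thesis unfolding \<chi>_def l_def by simp
  qed
  show ?thesis
  proof (intro exI[of _ \<chi>] conjI allI)
    fix x y
    obtain k l where kl: "x - of_int k \<in> G" "y - of_int l \<in> G"
      using cover by blast
    moreover have "x + y - of_int (k + l) \<in> G"
      using Gadd[OF kl] by (simp add: algebra_simps)
    ultimately show "\<chi> (x + y) = \<chi> x * \<chi> y"
      using chi[of "x + y" "k + l"] chi[of x k] chi[of y l] by (simp add: e_add)
  next
    fix x show "norm (\<chi> x) = 1" unfolding \<chi>_def e_def by simp
  next
    have "\<chi> 1 = e 1" using G0 by (intro chi) simp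
    moreover have "e 1 \<noteq> 1"
    proof
      assume "e 1 = 1"
      then have "cos (2 * pi / of_int p) = 1"
        unfolding e_def by (simp add: complex_eq_iff)
      then obtain n :: int where "2 * pi / of_int p = of_int n * 2 * pi"
        using cos_one_2pi_int by blast
      then have "1 = (of_int (n * p) :: real)"
        using p0 by (simp add: field_simps)
      then have "n * p = 1" by linarith
      then show False using p by (metis dvd_triv_right not_prime_unit)
    qed
    ultimately show "\<exists>x. \<chi> x \<noteq> 1" by metis
  qed
qed

section \<open>Subspaces and annihilators\<close>

text \<open>Models the space of dimension \<open>r\<close> inside one fixed function type, so that
  \<open>r\<close> is an ordinary variable and addition is pointwise.\<close>

definition coords :: "nat \<Rightarrow> (nat \<Rightarrow> 'a::field) set" where
  "coords r = {x. \<forall>i\<ge>r. x i = 0}"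

definition dot :: "nat \<Rightarrow> (nat \<Rightarrow> 'a::field) \<Rightarrow> (nat \<Rightarrow> 'a) \<Rightarrow> 'a" where
  "dot r x y = (\<Sum>i<r. x i * y i)"

definition scl :: "'a::field \<Rightarrow> (nat \<Rightarrow> 'a) \<Rightarrow> (nat \<Rightarrow> 'a)" where
  "scl c x = (\<lambda>i. c * x i)"

definition subsp :: "nat \<Rightarrow> (nat \<Rightarrow> 'a::field) set \<Rightarrow> bool" where
  "subsp r U \<longleftrightarrow> U \<subseteq> coords r \<and> 0 \<in> U \<and> (\<forall>x\<in>U. \<forall>y\<in>U. x + y \<in> U) \<and> (\<forall>c. \<forall>x\<in>U. scl c x \<in> U)"

text \<open>The orthogonal complement. Frequencies are identified with vectors through
  \<open>dot\<close>, so for a subspace \<open>U\<close> this is also the group of characters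
  trivial on \<open>U\<close>.\<close>

definition annih :: "nat \<Rightarrow> (nat \<Rightarrow> 'a::field) set \<Rightarrow> (nat \<Rightarrow> 'a) set" where
  "annih r U = {x \<in> coords r. \<forall>u\<in>U. dot r x u = 0}"

lemma scl_apply [simp]: "scl c x i = c * x i"
  by (simp add: scl_def)

lemma scl_scl [simp]: "scl c (scl d x) = scl (c * d) x"
  by (simp add: scl_def mult.assoc)

lemma scl_one [simp]: "scl 1 x = x"
  by (simp add: scl_def)

lemma scl_minus_one: "scl (-1) x = - x"
  by (simp add: scl_def fun_eq_iff)

lemma dot_commute: "dot r x y = dot r y x"
  by (simp add: dot_def mult.commute)

lemma dot_add_right: "dot r x (y + z) = dot r x y + dot r x z"
  by (simp add: dot_def distrib_left sum.distrib)

lemma dot_diff_right: "dot r x (y - z) = dot r x y - dot r x z"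
  by (simp add: dot_def right_diff_distrib sum_subtractf)

lemma dot_zero_right [simp]: "dot r x 0 = 0"
  by (simp add: dot_def)

lemma dot_scl_right: "dot r x (scl c y) = c * dot r x y"
  by (simp add: dot_def sum_distrib_left mult_ac)

lemma dot_scl_left: "dot r (scl c x) y = c * dot r x y"
  by (simp add: dot_def sum_distrib_left mult_ac)

lemma dot_add_left: "dot r (x + y) z = dot r x z + dot r y z"
  by (simp add: dot_def distrib_right sum.distrib)

lemma subsp_coords: "subsp r (coords r)"
  by (auto simp: subsp_def coords_def)

lemma subspD:
  assumes "subsp r U"
  shows "U \<subseteq> coords r" "0 \<in> U" "x \<in> U \<Longrightarrow> y \<in> U \<Longrightarrow> x + y \<in> U" "x \<in> U \<Longrightarrow> scl c x \<in> U"
    "x \<in> U \<Longrightarrow> y \<in> U \<Longrightarrow> x - y \<in> U"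
proof -
  show *: "U \<subseteq> coords r" "0 \<in> U" "x \<in> U \<Longrightarrow> y \<in> U \<Longrightarrow> x + y \<in> U" "x \<in> U \<Longrightarrow> scl c x \<in> U" for x y c
    using assms by (auto simp: subsp_def)
  show "x \<in> U \<Longrightarrow> y \<in> U \<Longrightarrow> x - y \<in> U"
    using *(3)[of x "scl (-1) y"] *(4)[of y "-1"] by (simp add: scl_minus_one)
qed

lemma coords_diff: "x \<in> coords r \<Longrightarrow> y \<in> coords r \<Longrightarrow> x - y \<in> coords r"
  and coords_add: "x \<in> coords r \<Longrightarrow> y \<in> coords r \<Longrightarrow> x + y \<in> coords r"
  and coords_scl: "x \<in> coords r \<Longrightarrow> scl c x \<in> coords r"
  by (auto simp: coords_def)

lemma subsp_annih: "subsp r (annih r U)"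
  by (auto simp: subsp_def annih_def coords_def dot_add_left dot_scl_left)
    (simp add: dot_def)

section \<open>Cardinalities of coordinate spaces and subspaces\<close>

lemma bij_betw_coords_PiE:
  "bij_betw (\<lambda>x. restrict x {..<r}) (coords r) (PiE {..<r} (\<lambda>_. UNIV))"
  by (rule bij_betw_byWitness[where f' = "\<lambda>g i. if i < r then g i else 0"])
    (auto simp: coords_def fun_eq_iff PiE_def extensional_def)

lemma finite_coords [simp]: "finite (coords r :: (nat \<Rightarrow> 'a::{field,finite}) set)"
  using bij_betw_finite[OF bij_betw_coords_PiE[of r, where 'a = 'a]]
  by (simp add: finite_PiE)

lemma card_coords: "card (coords r :: (nat \<Rightarrow> 'a::{field,finite}) set) = CARD('a) ^ r"
  using bij_betw_same_card[OF bij_betw_coords_PiE[of r, where 'a = 'a]]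
  by (simp add: card_PiE)

lemma finite_subsp: "subsp r U \<Longrightarrow> finite (U :: (nat \<Rightarrow> 'a::{field,finite}) set)"
  using finite_subset[OF subspD(1)] finite_coords by blast

lemma sum_coords_scl:
  fixes F :: "(nat \<Rightarrow> 'a::{field,finite}) \<Rightarrow> 'b::comm_monoid_add"
  assumes "c \<noteq> 0"
  shows "(\<Sum>x\<in>coords r. F (scl c x)) = (\<Sum>x\<in>coords r. F x)"
  by (rule sum.reindex_bij_witness[of _ "scl (inverse c)" "scl c"])
    (use assms in \<open>auto simp: coords_scl\<close>)

lemma sum_coords_shift:
  fixes F :: "(nat \<Rightarrow> 'a::{field,finite}) \<Rightarrow> 'b::comm_monoid_add"
  assumes "a \<in> coords r"
  shows "(\<Sum>x\<in>coords r. F (x - a)) = (\<Sum>x\<in>coords r. F x)"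
  by (rule sum.reindex_bij_witness[of _ "\<lambda>x. x + a" "\<lambda>x. x - a"])
    (use assms in \<open>auto simp: coords_add coords_diff\<close>)

text \<open>Multiples of \<open>u\<close> realize every value of the functional, so all its fibres
  on \<open>U\<close> are translates of the kernel.\<close>

lemma card_subsp_hyperplane:
  fixes U :: "(nat \<Rightarrow> 'a::{field,finite}) set"
  assumes "subsp r U" "u \<in> U" "dot r \<eta> u \<noteq> 0"
  shows "subsp r {x \<in> U. dot r \<eta> x = 0}"
    and "card U = CARD('a) * card {x \<in> U. dot r \<eta> x = 0}"
proof -
  note U = subspD[OF assms(1)]
  let ?U = "\<lambda>t. {x \<in> U. dot r \<eta> x = t}"
  show "subsp r (?U 0)"
    using U by (auto simp: subsp_def dot_add_right dot_scl_right)
  have fin: "finite U" by (rule finite_subsp[OF assms(1)])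
  have fibre: "card (?U t) = card (?U 0)" for t
  proof -
    define v where "v = scl (t / dot r \<eta> u) u"
    have v: "v \<in> U" "dot r \<eta> v = t"
      using assms U unfolding v_def by (auto simp: dot_scl_right)
    have "bij_betw (\<lambda>x. x - v) (?U t) (?U 0)"
      by (rule bij_betw_byWitness[where f' = "\<lambda>x. x + v"])
        (use v U in \<open>auto simp: dot_diff_right dot_add_right\<close>)
    then show ?thesis by (rule bij_betw_same_card)
  qed
  have "card U = (\<Sum>t\<in>UNIV. card (?U t))"
    using sum.group[of U UNIV "dot r \<eta>" "\<lambda>_. 1 :: nat"] fin by simp
  also have "\<dots> = (\<Sum>t\<in>(UNIV :: 'a set). card (?U 0))"
    by (intro sum.cong refl fibre)
  finally show "card U = CARD('a) * card (?U 0)" by simp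
qed

text \<open>Each further element of \<open>S\<close> imposes one linear condition, which divides the
  cardinality by at most \<open>CARD('a)\<close>. It keeps the annihilator of a small set of
  frequencies large.\<close>

lemma card_annih_lower:
  fixes S :: "(nat \<Rightarrow> 'a::{field,finite}) set"
  assumes "finite S"
  shows "CARD('a) ^ r \<le> card (annih r S) * CARD('a) ^ card S"
  using assms
proof (induction S rule: finite_induct)
  case empty
  have "annih r {} = (coords r :: (nat \<Rightarrow> 'a) set)" by (simp add: annih_def)
  then show ?case by (simp add: card_coords)
next
  case (insert s S)
  have *: "annih r (insert s S) = {x \<in> annih r S. dot r s x = 0}"
    by (auto simp: annih_def dot_commute[of r s])
  have "card (annih r S) \<le> card (annih r (insert s S)) * CARD('a)"
  proof (cases "\<exists>u\<in>annih r S. dot r s u \<noteq> 0")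
    case True
    then obtain u where "u \<in> annih r S" "dot r s u \<noteq> 0" by blast
    from card_subsp_hyperplane(2)[OF subsp_annih this] show ?thesis
      unfolding * by (simp add: mult.commute)
  next
    case False
    then have "{x \<in> annih r S. dot r s x = 0} = annih r S" by auto
    then show ?thesis unfolding * by simp
  qed
  then have "card (annih r S) * CARD('a) ^ card S \<le> card (annih r (insert s S)) * CARD('a) * CARD('a) ^ card S"
    by (rule mult_right_mono) simp
  with insert show ?case by (auto simp: mult.assoc intro: order_trans)
qed

section \<open>Fourier analysis on a coordinate space\<close>

locale additive_character =
  fixes \<chi> :: "'a::{field,finite} \<Rightarrow> complex"
  assumes chi_add: "\<chi> (x + y) = \<chi> x * \<chi> y"
    and norm_chi [simp]: "norm (\<chi> x) = 1"
    and chi_nontrivial: "\<exists>x. \<chi> x \<noteq> 1"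
begin

lemma chi_zero [simp]: "\<chi> 0 = 1"
  using chi_add[of 0 0] norm_chi[of 0] by (metis add_0 mult_cancel_right1 norm_zero zero_neq_one)

lemma chi_minus: "\<chi> (- x) = cnj (\<chi> x)"
proof -
  have "\<chi> x * \<chi> (- x) = \<chi> x * cnj (\<chi> x)"
    using chi_add[of x "- x"] complex_norm_square[of "\<chi> x"] by simp
  then show ?thesis using norm_chi[of x] by (metis mult_cancel_left norm_zero zero_neq_one)
qed

lemma chi_diff: "\<chi> (x - y) = \<chi> x * cnj (\<chi> y)"
  using chi_add[of x "- y"] by (simp add: chi_minus)

lemma chi_sum: "finite I \<Longrightarrow> \<chi> (\<Sum>i\<in>I. f i) = (\<Prod>i\<in>I. \<chi> (f i))"
  by (induction I rule: finite_induct) (simp_all add: chi_add)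

text \<open>Unless the functional vanishes on \<open>U\<close>, some \<open>v\<close> in
  \<open>U\<close> has character value other than 1; translation by \<open>v\<close> preserves the
  sum but multiplies it by that value.\<close>

lemma sum_chi_subsp:
  fixes U :: "(nat \<Rightarrow> 'a) set"
  assumes "subsp r U"
  shows "(\<Sum>u\<in>U. \<chi> (dot r \<xi> u)) = (if \<forall>u\<in>U. dot r \<xi> u = 0 then of_nat (card U) else 0)"
proof (cases "\<forall>u\<in>U. dot r \<xi> u = 0")
  case True
  then show ?thesis by simp
next
  case False
  then obtain u where u: "u \<in> U" "dot r \<xi> u \<noteq> 0" by blast
  obtain t where t: "\<chi> t \<noteq> 1" using chi_nontrivial by blast
  define v where "v = scl (t / dot r \<xi> u) u"
  have v: "v \<in> U" "dot r \<xi> v = t"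
    using u subspD[OF assms] unfolding v_def by (auto simp: dot_scl_right)
  have "(\<Sum>w\<in>U. \<chi> (dot r \<xi> w)) = (\<Sum>w\<in>U. \<chi> (dot r \<xi> (w + v)))"
    by (rule sum.reindex_bij_witness[of _ "\<lambda>x. x + v" "\<lambda>x. x - v"])
      (use v subspD[OF assms] in auto)
  also have "\<dots> = (\<Sum>w\<in>U. \<chi> (dot r \<xi> w)) * \<chi> t"
    using v by (simp add: dot_add_right chi_add sum_distrib_right)
  finally have "(\<Sum>w\<in>U. \<chi> (dot r \<xi> w)) = 0"
    using t by simp
  with False show ?thesis by auto
qed

lemma sum_chi_coords:
  assumes "x \<in> coords r"
  shows "(\<Sum>\<xi>\<in>coords r. \<chi> (dot r \<xi> x)) = (if x = 0 then of_nat (CARD('a) ^ r) else 0)"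
proof (cases "x = 0")
  case True
  then show ?thesis by (simp add: card_coords)
next
  case False
  then obtain i where i: "x i \<noteq> 0" by (auto simp: fun_eq_iff)
  with assms have "i < r" by (auto simp: coords_def not_le[symmetric])
  \<comment> \<open>Pairing with the \<open>i\<close>-th unit vector picks out the nonzero
    coordinate of \<open>x\<close>. Symmetry of \<open>dot\<close> exchanges vector and frequency,
    so the orthogonality relation for subspaces applies.\<close>
  define u where "u = (\<lambda>j. if j = i then 1 else (0::'a))"
  have "dot r x u = (\<Sum>j<r. if j = i then x i else 0)"
    unfolding dot_def u_def by (intro sum.cong) auto
  then have "dot r x u = x i"
    using \<open>i < r\<close> by simp
  moreover have "u \<in> coords r"
    using \<open>i < r\<close> by (auto simp: u_def coords_def)
  ultimately have "\<not> (\<forall>u\<in>coords r. dot r x u = 0)" using i by metis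
  then have "(\<Sum>\<xi>\<in>coords r. \<chi> (dot r x \<xi>)) = 0"
    unfolding sum_chi_subsp[OF subsp_coords] by (rule if_not_P)
  with False show ?thesis
    by (simp add: dot_commute[of r x])
qed

text \<open>The unnormalized transform, with \<xi> standing for the character that sends
  \<open>x\<close> to \<open>\<chi> (dot r \<xi> x)\<close>; hence the factor
  \<open>CARD('a) ^ r\<close> in \<open>parseval\<close>.\<close>

definition ft :: "nat \<Rightarrow> ((nat \<Rightarrow> 'a) \<Rightarrow> real) \<Rightarrow> (nat \<Rightarrow> 'a) \<Rightarrow> complex" where
  "ft r g \<xi> = (\<Sum>x\<in>coords r. of_real (g x) * \<chi> (dot r \<xi> x))"

lemma parseval:
  "(\<Sum>\<xi>\<in>coords r. (norm (ft r g \<xi>))\<^sup>2) = real (CARD('a) ^ r) * (\<Sum>x\<in>coords r. (g x)\<^sup>2)"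
proof -
  let ?V = "coords r :: (nat \<Rightarrow> 'a) set"
  have "complex_of_real (\<Sum>\<xi>\<in>?V. (norm (ft r g \<xi>))\<^sup>2)
    = (\<Sum>\<xi>\<in>?V. ft r g \<xi> * cnj (ft r g \<xi>))"
    unfolding of_real_sum complex_norm_square ..
  also have "\<dots> = (\<Sum>\<xi>\<in>?V. \<Sum>x\<in>?V. \<Sum>y\<in>?V. of_real (g x * g y) * \<chi> (dot r \<xi> (x - y)))"
    unfolding ft_def cnj_sum sum_product
    by (intro sum.cong refl) (simp add: dot_diff_right chi_diff mult_ac)
  also have "\<dots> = (\<Sum>x\<in>?V. \<Sum>\<xi>\<in>?V. \<Sum>y\<in>?V. of_real (g x * g y) * \<chi> (dot r \<xi> (x - y)))"
    by (rule sum.swap)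
  also have "\<dots> = (\<Sum>x\<in>?V. \<Sum>y\<in>?V. \<Sum>\<xi>\<in>?V. of_real (g x * g y) * \<chi> (dot r \<xi> (x - y)))"
    by (intro sum.cong refl sum.swap)
  also have "\<dots> = (\<Sum>x\<in>?V. \<Sum>y\<in>?V. of_real (g x * g y) * (\<Sum>\<xi>\<in>?V. \<chi> (dot r \<xi> (x - y))))"
    by (simp add: sum_distrib_left)
  also have "\<dots> = (\<Sum>x\<in>?V. \<Sum>y\<in>?V. if x = y then of_real (g x * g y) * of_nat (CARD('a) ^ r) else 0)"
    by (intro sum.cong refl) (simp add: sum_chi_coords coords_diff)
  also have "\<dots> = (\<Sum>x\<in>?V. of_real (g x * g x) * of_nat (CARD('a) ^ r))"
    by (intro sum.cong refl) (simp add: sum.delta)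
  also have "\<dots> = complex_of_real (real (CARD('a) ^ r) * (\<Sum>x\<in>?V. (g x)\<^sup>2))"
    by (simp add: sum_distrib_left power2_eq_square mult_ac)
  finally show ?thesis by (simp only: of_real_eq_iff)
qed

section \<open>Transforms of indicators and duality of subspaces\<close>

lemma ft_indicator:
  assumes "B \<subseteq> coords r"
  shows "ft r (indicator B) \<xi> = (\<Sum>x\<in>B. \<chi> (dot r \<xi> x))"
proof -
  have "ft r (indicator B) \<xi> = (\<Sum>x\<in>coords r. if x \<in> B then \<chi> (dot r \<xi> x) else 0)"
    unfolding ft_def by (intro sum.cong) auto
  also have "\<dots> = (\<Sum>x\<in>coords r \<inter> B. \<chi> (dot r \<xi> x))"
    by (subst sum.inter_restrict) auto
  finally show ?thesis using assms by (simp add: Int_absorb1)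
qed

lemma sum_indicator_square_coords:
  assumes "B \<subseteq> (coords r :: (nat \<Rightarrow> 'a) set)"
  shows "(\<Sum>x\<in>coords r. (indicator B x :: real)\<^sup>2) = real (card B)"
proof -
  have "(\<Sum>x\<in>coords r. (indicator B x :: real)\<^sup>2) = (\<Sum>x\<in>coords r. indicator B x)"
    by (intro sum.cong) (auto simp: indicator_def)
  also have "\<dots> = real (card (coords r \<inter> B))"
    by (simp add: indicator_def sum.If_cases Int_def)
  finally show ?thesis using assms by (simp add: Int_absorb1)
qed

lemma norm_ft_indicator_le:
  assumes "B \<subseteq> coords r"
  shows "norm (ft r (indicator B) \<xi>) \<le> real (card B)"
  unfolding ft_indicator[OF assms]
  using norm_sum[of "\<lambda>x. \<chi> (dot r \<xi> x)" B] by simp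

text \<open>This is Parseval for the indicator of \<open>U\<close>, whose transform equals
  \<open>card U\<close> on the annihilator and 0 elsewhere.\<close>

lemma card_annih_subsp:
  fixes U :: "(nat \<Rightarrow> 'a) set"
  assumes "subsp r U"
  shows "card (annih r U) * card U = CARD('a) ^ r"
proof -
  have fin: "finite U" by (rule finite_subsp[OF assms])
  have U: "U \<subseteq> coords r" "0 \<in> U" using subspD[OF assms] by auto
  have pos: "card U > 0" using fin U by (auto simp: card_gt_0_iff)
  have "real (card (annih r U)) * (real (card U))\<^sup>2 = (\<Sum>\<xi>\<in>coords r. if \<xi> \<in> annih r U then (real (card U))\<^sup>2 else 0)"
    by (subst sum.inter_restrict[symmetric]) (auto simp: annih_def Int_def)
  also have "\<dots> = (\<Sum>\<xi>\<in>coords r. (norm (ft r (indicator U) \<xi>))\<^sup>2)"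
    by (intro sum.cong refl) (auto simp: ft_indicator[OF U(1)] sum_chi_subsp[OF assms] annih_def)
  also have "\<dots> = real (CARD('a) ^ r) * real (card U)"
    unfolding parseval by (simp add: sum_indicator_square_coords[OF U(1)])
  finally have "real (card (annih r U) * card U) = real (CARD('a) ^ r)"
    using pos by (simp add: power2_eq_square)
  then show ?thesis by (simp only: of_nat_eq_iff)
qed

text \<open>One inclusion is immediate, and counting both annihilators shows that the two sides have
  equal cardinality.\<close>

lemma annih_annih:
  fixes U :: "(nat \<Rightarrow> 'a) set"
  assumes "subsp r U"
  shows "annih r (annih r U) = U"
proof -
  have "card (annih r (annih r U)) * card (annih r U) = card U * card (annih r U)"
    using card_annih_subsp[OF assms] card_annih_subsp[OF subsp_annih, of r U] by (simp add: mult.commute)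
  moreover have "card (annih r U) > 0"
    using subspD(2)[OF subsp_annih, of r U] finite_subsp[OF subsp_annih, of r U]
    by (auto simp: card_gt_0_iff)
  ultimately have "card (annih r (annih r U)) = card U" by simp
  moreover have "U \<subseteq> annih r (annih r U)"
    using subspD(1)[OF assms] by (auto simp: annih_def dot_commute)
  ultimately show ?thesis
    using card_subset_eq[OF finite_subsp[OF subsp_annih]] by metis
qed

end

section \<open>A five-term linear equation\<close>

text \<open>The four factors other than \<open>z 0\<close> are at most the largest
  \<open>z j\<close>, whose fourth power is one of the summands.\<close>

lemma prod5_le_sum_power4:
  fixes z :: "nat \<Rightarrow> real"
  assumes "\<And>i. i < 5 \<Longrightarrow> 0 \<le> z i" and "z 0 \<le> d"
  shows "(\<Prod>i<5. z i) \<le> d * (\<Sum>i<5. z i ^ 4)"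
proof -
  have "Max (z ` {..<5}) \<in> z ` {..<5}"
    by (intro Max_in) (auto simp: lessThan_empty_iff)
  then obtain j where j: "j < 5" "z j = Max (z ` {..<5})"
    by auto
  have max: "z i \<le> z j" if "i < 5" for i
    unfolding j(2) using that by (intro Max_ge) auto
  have "(\<Prod>i<5. z i) = z 0 * (\<Prod>i\<in>{..<5} - {0}. z i)"
    by (rule prod.remove) auto
  also have "\<dots> \<le> d * (\<Prod>i\<in>{..<5::nat} - {0}. z j)"
    using order_trans[OF assms(1)[of 0] assms(2)] assms j(1) max assms(1)[of 0] by (intro mult_mono prod_mono prod_nonneg) auto
  also have "\<dots> = d * z j ^ 4"
    by simp
  also have "\<dots> \<le> d * (\<Sum>i<5. z i ^ 4)"
    using j(1) assms(1)[of 0] assms(2)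
    by (intro mult_left_mono member_le_sum) auto
  finally show ?thesis .
qed

text \<open>Since the values cancel, the positive ones carry half of the absolute sum, and there are
  at most \<open>card T\<close> of them. This turns a large Fourier coefficient into a fibre of
  excess density.\<close>

lemma exists_large_of_sum_zero:
  fixes D :: "'b \<Rightarrow> real"
  assumes "finite T" "T \<noteq> {}" "(\<Sum>t\<in>T. D t) = 0" "s \<le> (\<Sum>t\<in>T. \<bar>D t\<bar>)"
  shows "\<exists>t\<in>T. s / (2 * real (card T)) \<le> D t"
proof (rule ccontr)
  assume "\<not> ?thesis"
  then have less: "D t < s / (2 * real (card T))" if "t \<in> T" for t
    using that by force
  have card: "real (card T) > 0" using assms by (simp add: card_gt_0_iff)
  have "s > 0"
  proof (rule ccontr)
    assume "\<not> s > 0"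
    then have "s / (2 * real (card T)) \<le> 0" using card by (simp add: divide_nonpos_pos)
    then have "(\<Sum>t\<in>T. D t) < (\<Sum>t\<in>T. 0)"
      using less assms(1,2) by (intro sum_strict_mono) force+
    then show False using assms(3) by simp
  qed
  have "(\<Sum>t\<in>T. \<bar>D t\<bar>) = (\<Sum>t\<in>T. \<bar>D t\<bar> + D t)"
    using assms(3) by (simp add: sum.distrib)
  also have "\<dots> < (\<Sum>t\<in>T. s / real (card T))"
  proof (rule sum_strict_mono)
    fix t assume t: "t \<in> T"
    show "\<bar>D t\<bar> + D t < s / real (card T)"
      using less[OF t] \<open>s > 0\<close> card by (cases "D t \<ge> 0") (simp_all add: field_simps)
  qed (use assms in auto)
  also have "\<dots> = s" using card by simp
  finally show False using assms(4) by simp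
qed

section \<open>Counting solutions by Fourier analysis\<close>

lemma scl_in_annih_iff:
  assumes "c \<noteq> 0" "x \<in> coords r"
  shows "scl c x \<in> annih r U \<longleftrightarrow> x \<in> annih r U"
  using assms by (simp add: annih_def dot_scl_left coords_scl)

text \<open>Sum zero makes the equation invariant under translation; nonzero coefficients make each
  dilation of the frequencies a permutation. The absence of vanishing proper subsums is kept out of
  the locale, as it matters only when codes are translated into sets.\<close>

locale zero_sum_coefficients = additive_character \<chi> for \<chi> :: "'a::{field,finite} \<Rightarrow> complex" +
  fixes \<alpha> :: "nat \<Rightarrow> 'a"
  assumes alpha_nonzero: "i < 5 \<Longrightarrow> \<alpha> i \<noteq> 0"
    and alpha_sum: "(\<Sum>i<5. \<alpha> i) = 0"
begin

definition comb :: "(nat \<Rightarrow> nat \<Rightarrow> 'a) \<Rightarrow> nat \<Rightarrow> 'a" where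
  "comb x = (\<lambda>k. \<Sum>i<5. \<alpha> i * x i k)"

text \<open>Tuples are extensional on \<open>{..<5}\<close>, so that they form a finite set in which
  each solution is counted once.\<close>

definition sols :: "(nat \<Rightarrow> 'a) set \<Rightarrow> (nat \<Rightarrow> nat \<Rightarrow> 'a) set" where
  "sols B = {x \<in> PiE {..<5} (\<lambda>_. B). comb x = 0}"

definition weighted_sols :: "nat \<Rightarrow> ((nat \<Rightarrow> 'a) \<Rightarrow> real) \<Rightarrow> real" where
  "weighted_sols r g = (\<Sum>x\<in>sols (coords r). \<Prod>i<5. g (x i))"

lemma finite_sols: "finite B \<Longrightarrow> finite (sols B)"
  unfolding sols_def by (simp add: finite_PiE)

lemma comb_in_coords: "x \<in> PiE {..<5} (\<lambda>_. coords r) \<Longrightarrow> comb x \<in> coords r"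
  by (auto simp: comb_def coords_def PiE_def Pi_def)

lemma dot_comb: "dot r \<xi> (comb x) = (\<Sum>i<5. dot r (scl (\<alpha> i) \<xi>) (x i))"
  unfolding dot_def comb_def sum_distrib_left
  by (subst sum.swap) (simp add: mult_ac)

text \<open>Expanding the product gives a sum over all tuples, and orthogonality in \<xi> keeps
  those with \<open>comb x = 0\<close>.\<close>

lemma weighted_sols_fourier:
  "complex_of_real (real (CARD('a) ^ r) * weighted_sols r g)
    = (\<Sum>\<xi>\<in>coords r. \<Prod>i<5. ft r g (scl (\<alpha> i) \<xi>))"
proof -
  let ?V = "coords r :: (nat \<Rightarrow> 'a) set"
  let ?P = "PiE {..<5::nat} (\<lambda>_. ?V)"
  have "(\<Sum>\<xi>\<in>?V. \<Prod>i<5. ft r g (scl (\<alpha> i) \<xi>))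
    = (\<Sum>\<xi>\<in>?V. \<Sum>x\<in>?P. of_real (\<Prod>i<5. g (x i)) * \<chi> (dot r \<xi> (comb x)))"
    unfolding ft_def dot_comb
    by (intro sum.cong refl, subst prod_sum_PiE) (simp_all add: prod.distrib chi_sum)
  also have "\<dots> = (\<Sum>x\<in>?P. of_real (\<Prod>i<5. g (x i)) * (\<Sum>\<xi>\<in>?V. \<chi> (dot r \<xi> (comb x))))"
    by (subst sum.swap) (simp add: sum_distrib_left)
  also have "\<dots> = (\<Sum>x\<in>?P. if comb x = 0 then of_real (\<Prod>i<5. g (x i)) * of_nat (CARD('a) ^ r) else 0)"
    by (intro sum.cong refl) (simp add: sum_chi_coords comb_in_coords)
  also have "\<dots> = (\<Sum>x\<in>sols ?V. of_real (\<Prod>i<5. g (x i)) * of_nat (CARD('a) ^ r))"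
    unfolding sols_def by (subst sum.inter_filter) (simp_all add: finite_PiE)
  also have "\<dots> = complex_of_real (real (CARD('a) ^ r) * weighted_sols r g)"
    unfolding weighted_sols_def by (simp add: sum_distrib_left mult.commute)
  finally show ?thesis ..
qed

lemma weighted_sols_indicator:
  assumes "B \<subseteq> coords r"
  shows "weighted_sols r (indicator B) = real (card (sols B))"
proof -
  have "(\<Prod>i<5. indicator B (x i) :: real) = (if x \<in> sols B then 1 else 0)" if "x \<in> sols (coords r)" for x
    using that by (auto simp: sols_def PiE_def Pi_def indicator_def prod_zero_iff)
  then have "weighted_sols r (indicator B) = (\<Sum>x\<in>sols (coords r). if x \<in> sols B then 1 else 0)"
    unfolding weighted_sols_def by (intro sum.cong) auto
  also have "\<dots> = real (card (sols (coords r) \<inter> sols B))"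
    by (simp add: sum.If_cases finite_sols Int_def)
  also have "sols (coords r) \<inter> sols B = sols B"
    using assms by (auto simp: sols_def)
  finally show ?thesis .
qed

text \<open>Smallness of the factor with index 0 suffices: the others are controlled by fourth
  powers. Dilation by each \<alpha>-coefficient permutes the frequencies, so the five fourth moments
  agree, whence the factor 5.\<close>

lemma norm_sum_prod_ft_le:
  assumes "X \<subseteq> coords r" "\<And>\<xi>. \<xi> \<in> X \<Longrightarrow> norm (ft r g (scl (\<alpha> 0) \<xi>)) \<le> d" "0 \<le> d"
  shows "norm (\<Sum>\<xi>\<in>X. \<Prod>i<5. ft r g (scl (\<alpha> i) \<xi>)) \<le> 5 * d * (\<Sum>\<xi>\<in>coords r. norm (ft r g \<xi>) ^ 4)"
proof -
  have "norm (\<Sum>\<xi>\<in>X. \<Prod>i<5. ft r g (scl (\<alpha> i) \<xi>)) \<le> (\<Sum>\<xi>\<in>X. \<Prod>i<5. norm (ft r g (scl (\<alpha> i) \<xi>)))"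
    by (intro sum_norm_le) (simp add: prod_norm)
  also have "\<dots> \<le> (\<Sum>\<xi>\<in>X. d * (\<Sum>i<5. norm (ft r g (scl (\<alpha> i) \<xi>)) ^ 4))"
    by (intro sum_mono prod5_le_sum_power4 assms) simp_all
  also have "\<dots> \<le> (\<Sum>\<xi>\<in>coords r. d * (\<Sum>i<5. norm (ft r g (scl (\<alpha> i) \<xi>)) ^ 4))"
    using assms by (intro sum_mono2) (auto intro!: mult_nonneg_nonneg sum_nonneg)
  also have "\<dots> = d * (\<Sum>i<5. \<Sum>\<xi>\<in>coords r. norm (ft r g (scl (\<alpha> i) \<xi>)) ^ 4)"
    by (simp add: sum_distrib_left[symmetric] sum.swap[of _ "coords r"])
  also have "\<dots> = d * (\<Sum>i<5::nat. \<Sum>\<xi>\<in>coords r. norm (ft r g \<xi>) ^ 4)"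
    using sum_coords_scl[OF alpha_nonzero, where F = "\<lambda>\<xi>. norm (ft r g \<xi>) ^ 4"] by simp
  finally show ?thesis by simp
qed

lemma sum_prod_ft_annih:
  assumes "subsp r U" "B \<subseteq> U"
  shows "(\<Sum>\<xi>\<in>annih r U. \<Prod>i<5. ft r (indicator B) (scl (\<alpha> i) \<xi>))
    = of_real (real (card (annih r U)) * real (card B) ^ 5)"
proof -
  have B: "B \<subseteq> coords r" using assms subspD(1) by blast
  have "ft r (indicator B) (scl (\<alpha> i) \<xi>) = of_nat (card B)" if "\<xi> \<in> annih r U" for i \<xi>
    using that assms(2) by (auto simp: ft_indicator[OF B] annih_def dot_scl_left subset_iff)
  then show ?thesis by simp
qed

text \<open>Frequencies trivial on \<open>U\<close> give the main term. The others have coefficients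
  at most \<open>d\<close>, and their fourth moment is at most \<open>(card B)^2\<close> times the
  second moment given by Parseval. Division by
  \<open>CARD('a) ^ r = card (annih r U) * card U\<close> yields the normalization by
  \<open>card U\<close>.\<close>

lemma card_sols_ge:
  assumes U: "subsp r U" and B: "B \<subseteq> U" and "0 \<le> d"
    and small: "\<And>\<eta>. \<eta> \<in> coords r - annih r U \<Longrightarrow> norm (ft r (indicator B) \<eta>) \<le> d"
  shows "real (card B) ^ 5 / real (card U) - 5 * d * real (card B) ^ 3 \<le> real (card (sols B))"
proof -
  define N b u a where "N = real (CARD('a) ^ r)" and "b = real (card B)"
    and "u = real (card U)" and "a = real (card (annih r U))"
  have Bc: "B \<subseteq> coords r" using assms subspD(1) by blast
  have N: "N > 0" unfolding N_def by simp
  have auN: "a * u = N"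
    using card_annih_subsp[OF U] unfolding a_def u_def N_def by (metis of_nat_mult)
  then have u: "u > 0" using N unfolding u_def by (cases "card U = 0") auto
  have b: "b \<ge> 0" unfolding b_def by simp
  let ?F = "\<lambda>\<xi>. \<Prod>i<5. ft r (indicator B) (scl (\<alpha> i) \<xi>)"
  have "(\<Sum>\<xi>\<in>coords r. ?F \<xi>) = (\<Sum>\<xi>\<in>coords r - annih r U. ?F \<xi>) + (\<Sum>\<xi>\<in>annih r U. ?F \<xi>)"
    by (rule sum.subset_diff) (auto simp: annih_def)
  then have "complex_of_real (N * real (card (sols B)) - a * b ^ 5) = (\<Sum>\<xi>\<in>coords r - annih r U. ?F \<xi>)"
    using weighted_sols_fourier[of r "indicator B"]
    unfolding sum_prod_ft_annih[OF U B] weighted_sols_indicator[OF Bc] N_def a_def b_def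
    by (simp add: algebra_simps)
  then have "\<bar>N * real (card (sols B)) - a * b ^ 5\<bar> = norm (\<Sum>\<xi>\<in>coords r - annih r U. ?F \<xi>)"
    by (metis norm_of_real real_norm_def)
  also have "\<dots> \<le> 5 * d * (\<Sum>\<xi>\<in>coords r. norm (ft r (indicator B) \<xi>) ^ 4)"
    using alpha_nonzero[of 0] \<open>0 \<le> d\<close>
    by (intro norm_sum_prod_ft_le small) (auto simp: scl_in_annih_iff coords_scl)
  also have "\<dots> \<le> 5 * d * (\<Sum>\<xi>\<in>coords r. b\<^sup>2 * (norm (ft r (indicator B) \<xi>))\<^sup>2)"
  proof (intro mult_left_mono sum_mono)
    fix \<xi>
    have "norm (ft r (indicator B) \<xi>) \<le> b"
      unfolding b_def by (rule norm_ft_indicator_le[OF Bc])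
    then have "(norm (ft r (indicator B) \<xi>))\<^sup>2 * (norm (ft r (indicator B) \<xi>))\<^sup>2
        \<le> b\<^sup>2 * (norm (ft r (indicator B) \<xi>))\<^sup>2"
      by (intro mult_right_mono power_mono) auto
    then show "norm (ft r (indicator B) \<xi>) ^ 4 \<le> b\<^sup>2 * (norm (ft r (indicator B) \<xi>))\<^sup>2"
      by (simp add: power_add[symmetric])
  qed (use \<open>0 \<le> d\<close> in auto)
  also have "\<dots> = 5 * d * (b\<^sup>2 * (N * b))"
    unfolding sum_distrib_left[symmetric] parseval sum_indicator_square_coords[OF Bc] N_def b_def ..
  also have "\<dots> = N * (5 * d * b ^ 3)"
    by (simp add: power2_eq_square power3_eq_cube mult_ac)
  finally have "a * b ^ 5 - N * (5 * d * b ^ 3) \<le> N * real (card (sols B))"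
    by linarith
  moreover have "a * b ^ 5 = N * (b ^ 5 / u)"
    using u auN by (simp add: field_simps)
  ultimately have "N * (b ^ 5 / u - 5 * d * b ^ 3) \<le> N * real (card (sols B))"
    by (simp add: right_diff_distrib)
  then show ?thesis
    using N unfolding b_def u_def by simp
qed

section \<open>Dense sets contain many solutions\<close>

lemma card_sols_translate:
  assumes "finite B"
  shows "card (sols ((\<lambda>x. x - v) ` B)) \<le> card (sols B)"
proof (rule surj_card_le)
  show "finite (sols B)" by (rule finite_sols[OF assms])
  show "sols ((\<lambda>x. x - v) ` B) \<subseteq> (\<lambda>y. restrict (\<lambda>i. y i - v) {..<5}) ` sols B"
  proof
    fix x assume x: "x \<in> sols ((\<lambda>x. x - v) ` B)"
    define y where "y = restrict (\<lambda>i. x i + v) {..<5}"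
    \<comment> \<open>Adding \<open>v\<close> to every entry changes the combination by the
      coefficient sum times \<open>v\<close>, which is 0.\<close>
    have "comb y = (\<lambda>k. comb x k + (\<Sum>i<5. \<alpha> i) * v k)"
      unfolding y_def comb_def by (simp add: distrib_left sum.distrib sum_distrib_right)
    then have "comb y = 0"
      using x by (simp add: alpha_sum sols_def fun_eq_iff)
    moreover have "y \<in> PiE {..<5} (\<lambda>_. B)"
      using x unfolding sols_def y_def by (fastforce simp: PiE_def Pi_def)
    ultimately have "y \<in> sols B" by (simp add: sols_def)
    moreover have "x = restrict (\<lambda>i. y i - v) {..<5}"
      using x unfolding sols_def y_def by (auto simp: PiE_def extensional_def fun_eq_iff)
    ultimately show "x \<in> (\<lambda>y. restrict (\<lambda>i. y i - v) {..<5}) ` sols B" by blast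
  qed
qed

lemma card_sols_mono:
  assumes "finite B" "A \<subseteq> B"
  shows "card (sols A) \<le> card (sols B)"
  using assms by (intro card_mono finite_sols) (auto simp: sols_def PiE_def Pi_def)

text \<open>The frequency \<eta> is nontrivial on \<open>U\<close> and cuts it into translates of a
  hyperplane. Its Fourier coefficient is a character sum of the fibre sizes, so a large coefficient
  forces one fibre to be well above average.\<close>

lemma density_increment:
  assumes U: "subsp r U" and B: "B \<subseteq> U" and \<eta>: "\<eta> \<in> coords r - annih r U"
    and large: "s \<le> norm (ft r (indicator B) \<eta>)"
  shows "\<exists>U' B'. subsp r U' \<and> B' \<subseteq> U' \<and> card U = CARD('a) * card U' \<and>
    card (sols B') \<le> card (sols B) \<and>
    (real (card B) + s / 2) / real CARD('a) \<le> real (card B')"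
proof -
  let ?q = "real CARD('a)"
  have Bc: "B \<subseteq> coords r" using assms subspD(1) by blast
  have finB: "finite B" using finite_subset[OF Bc] by simp
  obtain u where u: "u \<in> U" "dot r \<eta> u \<noteq> 0"
    using \<eta> by (auto simp: annih_def)
  define U' where "U' = {x \<in> U. dot r \<eta> x = 0}"
  define Bt where "Bt t = {x \<in> B. dot r \<eta> x = t}" for t
  \<comment> \<open>The deviation from the mean fibre size. Subtracting the mean leaves the
    character sum unchanged because \<chi> sums to 0 over the field.\<close>
  define D where "D t = real (card (Bt t)) - real (card B) / ?q" for t
  have "(\<Sum>t\<in>UNIV. card (Bt t)) = card B"
    using sum.group[of B UNIV "dot r \<eta>" "\<lambda>_. 1 :: nat"] finB unfolding Bt_def by simp
  then have "(\<Sum>t\<in>UNIV. real (card (Bt t))) = real (card B)"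
    by (metis of_nat_sum)
  then have D0: "(\<Sum>t\<in>UNIV. D t) = 0"
    unfolding D_def by (simp add: sum_subtractf)
  have chi0: "(\<Sum>t\<in>UNIV. \<chi> t) = 0"
  proof -
    obtain w where w: "\<chi> w \<noteq> 1" using chi_nontrivial by blast
    have "(\<Sum>t\<in>UNIV. \<chi> t) = (\<Sum>t\<in>UNIV. \<chi> (t + w))"
      by (rule sum.reindex_bij_witness[of _ "\<lambda>x. x + w" "\<lambda>x. x - w"]) auto
    also have "\<dots> = (\<Sum>t\<in>UNIV. \<chi> t) * \<chi> w"
      by (simp add: chi_add sum_distrib_right)
    finally show ?thesis using w by simp
  qed
  have "ft r (indicator B) \<eta> = (\<Sum>x\<in>B. \<chi> (dot r \<eta> x))"
    by (rule ft_indicator[OF Bc])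
  also have "\<dots> = (\<Sum>t\<in>UNIV. \<Sum>x\<in>Bt t. \<chi> (dot r \<eta> x))"
    unfolding Bt_def by (rule sum.group[symmetric]) (use finB in auto)
  also have "\<dots> = (\<Sum>t\<in>UNIV. of_real (real (card (Bt t))) * \<chi> t)"
    by (intro sum.cong refl) (simp add: Bt_def)
  also have "\<dots> = (\<Sum>t\<in>UNIV. of_real (D t) * \<chi> t)"
    unfolding D_def of_real_diff left_diff_distrib sum_subtractf
    by (simp only: sum_distrib_left[symmetric] chi0) simp
  finally have "norm (ft r (indicator B) \<eta>) \<le> (\<Sum>t\<in>UNIV. \<bar>D t\<bar>)"
    using norm_sum[of "\<lambda>t. of_real (D t) * \<chi> t" UNIV] by (simp add: norm_mult)
  with large have "s \<le> (\<Sum>t\<in>UNIV. \<bar>D t\<bar>)" by linarith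
  then obtain t where t: "s / (2 * ?q) \<le> D t"
    using exists_large_of_sum_zero[OF _ _ D0] by auto
  \<comment> \<open>A point of \<open>U\<close> in the chosen fibre; subtracting it moves that fibre
    into the hyperplane.\<close>
  define v where "v = scl (t / dot r \<eta> u) u"
  have v: "v \<in> U" "dot r \<eta> v = t"
    using u subspD[OF U] unfolding v_def by (auto simp: dot_scl_right)
  define B' where "B' = (\<lambda>x. x - v) ` Bt t"
  have "subsp r U'" "card U = CARD('a) * card U'"
    unfolding U'_def using card_subsp_hyperplane[OF U u] by auto
  moreover have "B' \<subseteq> U'"
    unfolding B'_def U'_def Bt_def using v B subspD[OF U] by (auto simp: dot_diff_right)
  moreover have "card (sols B') \<le> card (sols B)"
    unfolding B'_def Bt_def
    by (rule order_trans[OF card_sols_translate card_sols_mono]) (use finB in auto)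
  moreover have "card B' = card (Bt t)"
    unfolding B'_def by (rule card_image) (simp add: inj_on_def)
  then have "(real (card B) + s / 2) / ?q \<le> real (card B')"
    using t unfolding D_def by (simp add: field_simps)
  ultimately show ?thesis by blast
qed

text \<open>Density increment: either the Fourier coefficients outside the annihilator are small and
  the solutions are counted by the main term, or the density grows from \<open>\<beta>\<close> to at least
  \<open>\<beta> + \<beta>\<^sup>2 / 20\<close> on a translate of a hyperplane.\<close>

lemma card_sols_lower_bound:
  assumes "0 < \<beta>"
  shows "\<exists>c>0. \<forall>r U B. subsp r U \<longrightarrow> B \<subseteq> U \<longrightarrow> \<beta> * real (card U) \<le> real (card B) \<longrightarrow>
    c * real (card U) ^ 4 \<le> real (card (sols B))"
proof -
  let ?P = "\<lambda>\<beta> c. \<forall>r U B. subsp r U \<longrightarrow> B \<subseteq> U \<longrightarrow> \<beta> * real (card U) \<le> real (card B) \<longrightarrow>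
    c * real (card U) ^ 4 \<le> real (card (sols B))"
  define q where "q = real CARD('a)"
  have q: "q > 0" unfolding q_def by simp
  \<comment> \<open>Here \<open>k\<close> bounds the number of increments still possible: each
    raises the density by at least \<open>\<beta>^2 / 20\<close>, and a density cannot exceed
    1.\<close>
  have "\<exists>c>0. ?P \<gamma> c" if "\<beta> \<le> \<gamma>" "1 - real k * (\<beta>\<^sup>2 / 20) < \<gamma>" for \<gamma> k
    using that
  proof (induction k arbitrary: \<gamma>)
    case 0
    have False if "subsp r U" "B \<subseteq> U" "\<gamma> * real (card U) \<le> real (card B)"
      for r and U B :: "(nat \<Rightarrow> 'a) set"
    proof -
      have "finite U" "0 \<in> U" using finite_subsp subspD(2) that(1) by auto
      then have "real (card B) \<le> real (card U)" "real (card U) > 0"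
        using that(2) by (auto simp: card_mono card_gt_0_iff)
      moreover from this 0 have "1 * real (card U) < \<gamma> * real (card U)"
        by (intro mult_strict_right_mono) auto
      ultimately show False using that(3) by linarith
    qed
    \<comment> \<open>No set has density above 1, so any positive constant serves.\<close>
    then show ?case by (intro exI[of _ 1]) auto
  next
    case (Suc k)
    have \<gamma>: "\<gamma> > 0" using Suc.prems assms by linarith
    have "\<beta>\<^sup>2 \<le> \<gamma>\<^sup>2" using Suc.prems assms by (intro power_mono) auto
    moreover have "real (Suc k) * (\<beta>\<^sup>2 / 20) = real k * (\<beta>\<^sup>2 / 20) + \<beta>\<^sup>2 / 20"
      by (simp add: algebra_simps)
    ultimately have "1 - real k * (\<beta>\<^sup>2 / 20) < \<gamma> + \<gamma>\<^sup>2 / 20" "\<beta> \<le> \<gamma> + \<gamma>\<^sup>2 / 20"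
      using Suc.prems zero_le_power2[of \<gamma>] by linarith+
    then have "\<exists>c>0. ?P (\<gamma> + \<gamma>\<^sup>2 / 20) c"
      by (intro Suc.IH)
    then obtain c where c: "c > 0" "?P (\<gamma> + \<gamma>\<^sup>2 / 20) c" by blast
    \<comment> \<open>The first entry is half of the main term. The second comes from the
      hyperplane, where \<open>card U\<close> has shrunk by the factor \<open>q\<close> and its
      fourth power by \<open>q ^ 4\<close>.\<close>
    have "min (\<gamma> ^ 5 / 2) (c / q ^ 4) > 0" using \<gamma> c q by simp
    moreover have "?P \<gamma> (min (\<gamma> ^ 5 / 2) (c / q ^ 4))"
    proof (intro allI impI)
      fix r and U B :: "(nat \<Rightarrow> 'a) set"
      assume U: "subsp r U" and B: "B \<subseteq> U" and dens: "\<gamma> * real (card U) \<le> real (card B)"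
      define u b where "u = real (card U)" and "b = real (card B)"
      \<comment> \<open>With this threshold the error \<open>5 * d * b ^ 3\<close> is exactly half
        of the main term \<open>b ^ 5 / u\<close>, and the increment \<open>d / 2\<close> is
        \<open>b^2 / (20 * u)\<close>.\<close>
      define d where "d = b\<^sup>2 / (10 * u)"
      have "finite U" "0 \<in> U" using finite_subsp subspD(2) U by auto
      then have u: "u > 0" unfolding u_def by (auto simp: card_gt_0_iff)
      have b: "\<gamma> * u \<le> b" using dens unfolding u_def b_def .
      have d: "d \<ge> 0" unfolding d_def using u by simp
      show "min (\<gamma> ^ 5 / 2) (c / q ^ 4) * real (card U) ^ 4 \<le> real (card (sols B))"
      proof (cases "\<forall>\<eta>\<in>coords r - annih r U. norm (ft r (indicator B) \<eta>) \<le> d")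
        case True
        have "\<gamma> ^ 5 / 2 * u ^ 4 = (\<gamma> * u) ^ 5 / (2 * u)"
          using u by (simp add: field_simps eval_nat_numeral)
        also have "\<dots> \<le> b ^ 5 / (2 * u)"
          using b u \<gamma> by (intro divide_right_mono power_mono) auto
        also have "\<dots> = b ^ 5 / u - 5 * d * b ^ 3"
          using u unfolding d_def by (simp add: field_simps eval_nat_numeral)
        also have "\<dots> \<le> real (card (sols B))"
          unfolding b_def u_def using card_sols_ge[OF U B d] True by blast
        finally have "\<gamma> ^ 5 / 2 * u ^ 4 \<le> real (card (sols B))" .
        moreover have "min (\<gamma> ^ 5 / 2) (c / q ^ 4) * u ^ 4 \<le> \<gamma> ^ 5 / 2 * u ^ 4"
          using u by (intro mult_right_mono min.cobounded1) auto
        ultimately show ?thesis unfolding u_def by linarith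
      next
        case False
        then obtain \<eta> where \<eta>: "\<eta> \<in> coords r - annih r U" "d \<le> norm (ft r (indicator B) \<eta>)"
          by force
        obtain U' B' where U': "subsp r U'" "B' \<subseteq> U'" "card U = CARD('a) * card U'"
          "card (sols B') \<le> card (sols B)" "(b + d / 2) / q \<le> real (card B')"
          using density_increment[OF U B \<eta>] unfolding b_def q_def by blast
        have u': "u = q * real (card U')"
          unfolding u_def q_def U'(3) by simp
        have "(\<gamma> + \<gamma>\<^sup>2 / 20) * u = \<gamma> * u + (\<gamma> * u)\<^sup>2 / (20 * u)"
          using u by (simp add: field_simps power2_eq_square)
        also have "\<dots> \<le> b + b\<^sup>2 / (20 * u)"
          using b u \<gamma> by (intro add_mono divide_right_mono power_mono) auto
        also have "\<dots> = b + d / 2" unfolding d_def by simp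
        also have "\<dots> \<le> q * real (card B')"
          using U'(5) q by (simp add: field_simps)
        finally have "(\<gamma> + \<gamma>\<^sup>2 / 20) * real (card U') \<le> real (card B')"
          unfolding u' using q by (simp add: mult_ac)
        then have "c * real (card U') ^ 4 \<le> real (card (sols B'))"
          using c(2) U' by blast
        also have "\<dots> \<le> real (card (sols B))" using U'(4) by simp
        also have "c * real (card U') ^ 4 = c / q ^ 4 * u ^ 4"
          unfolding u' using q by (simp add: field_simps)
        finally have "c / q ^ 4 * u ^ 4 \<le> real (card (sols B))" .
        moreover have "min (\<gamma> ^ 5 / 2) (c / q ^ 4) * u ^ 4 \<le> c / q ^ 4 * u ^ 4"
          using u by (intro mult_right_mono min.cobounded2) auto
        ultimately show ?thesis unfolding u_def by linarith
      qed
    qed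
    ultimately show ?case by blast
  qed
  moreover obtain k where "(1 - \<beta>) / (\<beta>\<^sup>2 / 20) < real k"
    using reals_Archimedean2 by blast
  then have "1 - real k * (\<beta>\<^sup>2 / 20) < \<beta>"
    using assms by (simp add: field_simps)
  ultimately show ?thesis by blast
qed

end

section \<open>Sidon sets without nontrivial solutions\<close>

text \<open>The difference form of the usual condition that \<open>x + w = z + y\<close> holds only
  when the two pairs agree up to order.\<close>

definition sidon :: "'b::ab_group_add set \<Rightarrow> bool" where
  "sidon A \<longleftrightarrow> (\<forall>x\<in>A. \<forall>y\<in>A. \<forall>z\<in>A. \<forall>w\<in>A. x - y = z - w \<longrightarrow> x \<noteq> y \<longrightarrow> x = z)"

definition rep :: "'b::ab_group_add set \<Rightarrow> 'b \<Rightarrow> nat" where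
  "rep A d = card {p \<in> A \<times> A. fst p - snd p = d}"

section \<open>Differences in a Sidon set\<close>

lemma rep_zero: "rep A 0 = card A"
proof -
  have "bij_betw (\<lambda>a. (a, a)) A {p \<in> A \<times> A. fst p - snd p = 0}"
    by (rule bij_betw_byWitness[where f' = fst]) auto
  then show ?thesis unfolding rep_def by (simp add: bij_betw_same_card)
qed

lemma rep_le_one:
  assumes "sidon A" "finite A" "d \<noteq> 0"
  shows "rep A d \<le> 1"
proof -
  have "p = p'" if "p \<in> {p \<in> A \<times> A. fst p - snd p = d}" "p' \<in> {p \<in> A \<times> A. fst p - snd p = d}" for p p'
  proof -
    obtain x y z w where p: "p = (x, y)" "p' = (z, w)" by fastforce
    with that assms(3) have "x \<in> A" "y \<in> A" "z \<in> A" "w \<in> A" "x - y = z - w" "x \<noteq> y" by auto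
    moreover from this have "x = z" using assms(1) unfolding sidon_def by blast
    ultimately show ?thesis using p by simp
  qed
  then show ?thesis
    unfolding rep_def One_nat_def using assms(2) by (subst card_le_Suc0_iff_eq) auto
qed

lemma sum_rep:
  assumes "finite A" "finite D" "\<And>x y. x \<in> A \<Longrightarrow> y \<in> A \<Longrightarrow> x - y \<in> D"
  shows "(\<Sum>d\<in>D. real (rep A d)) = (real (card A))\<^sup>2"
proof -
  have "(\<Sum>d\<in>D. rep A d) = card (A \<times> A)"
  proof -
    have "(\<lambda>p. fst p - snd p) ` (A \<times> A) \<subseteq> D" using assms(3) by auto
    then show ?thesis
      using sum.group[of "A \<times> A" D "\<lambda>p. fst p - snd p" "\<lambda>_. 1 :: nat"] assms(1,2)
      unfolding rep_def by simp
  qed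
  then show ?thesis
    by (metis card_cartesian_product of_nat_mult of_nat_sum power2_eq_square)
qed

text \<open>The difference 0 has \<open>card A\<close> representations and every other one at most
  one.\<close>

lemma sum_rep_le:
  assumes "sidon A" "finite A" "finite D"
  shows "(\<Sum>d\<in>D. real (rep A d)) \<le> real (card A) + real (card D)"
proof -
  have "(\<Sum>d\<in>D. real (rep A d)) \<le> (\<Sum>d\<in>D. (if d = 0 then real (card A) else 0) + 1)"
    using rep_le_one[OF assms(1,2)] by (intro sum_mono) (auto simp: rep_zero)
  also have "\<dots> \<le> real (card A) + real (card D)"
    using assms(3) by (simp add: sum.distrib)
  finally show ?thesis .
qed

context additive_character begin

text \<open>The transform of the difference count is the squared modulus of the transform of
  \<open>A\<close>, so Parseval turns the fourth moment into the sum of \<open>(rep A d)^2\<close>.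
  The difference 0 contributes \<open>(card A)^2\<close>; elsewhere the square is at most
  \<open>rep A d\<close>, with total at most \<open>(card A)^2\<close>.\<close>

lemma sum_norm_ft_power4_le:
  assumes "sidon A" "A \<subseteq> coords r"
  shows "(\<Sum>\<xi>\<in>coords r. norm (ft r (indicator A) \<xi>) ^ 4) \<le> 2 * (real (card A))\<^sup>2 * real (CARD('a) ^ r)"
proof -
  have finA: "finite A" using finite_subset[OF assms(2)] by simp
  let ?\<rho> = "\<lambda>d. real (rep A d)"
  have ft: "ft r ?\<rho> \<xi> = of_real ((norm (ft r (indicator A) \<xi>))\<^sup>2)" for \<xi>
  proof -
    have "ft r ?\<rho> \<xi> = (\<Sum>d\<in>coords r. \<Sum>p\<in>{p \<in> A \<times> A. fst p - snd p = d}. \<chi> (dot r \<xi> (fst p - snd p)))"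
      unfolding ft_def rep_def by (intro sum.cong refl) simp
    also have "\<dots> = (\<Sum>p\<in>A \<times> A. \<chi> (dot r \<xi> (fst p - snd p)))"
      by (rule sum.group) (use finA assms(2) coords_diff in fastforce)+
    also have "\<dots> = (\<Sum>x\<in>A. \<Sum>y\<in>A. \<chi> (dot r \<xi> x) * cnj (\<chi> (dot r \<xi> y)))"
      unfolding sum.cartesian_product by (simp add: split_def dot_diff_right chi_diff)
    also have "\<dots> = of_real ((norm (ft r (indicator A) \<xi>))\<^sup>2)"
      unfolding complex_norm_square ft_indicator[OF assms(2)] cnj_sum sum_product ..
    finally show ?thesis .
  qed
  have "(\<Sum>\<xi>\<in>coords r. norm (ft r (indicator A) \<xi>) ^ 4) = (\<Sum>\<xi>\<in>coords r. (norm (ft r ?\<rho> \<xi>))\<^sup>2)"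
    unfolding ft norm_of_real by (simp flip: power_mult)
  also have "\<dots> = real (CARD('a) ^ r) * (\<Sum>d\<in>coords r. (?\<rho> d)\<^sup>2)"
    by (rule parseval)
  also have "\<dots> \<le> real (CARD('a) ^ r) * (\<Sum>d\<in>coords r. (if d = 0 then (real (card A))\<^sup>2 else 0) + ?\<rho> d)"
  proof (intro mult_left_mono sum_mono)
    fix d :: "nat \<Rightarrow> 'a"
    have "?\<rho> d \<le> 1" if "d \<noteq> 0"
      using rep_le_one[OF assms(1) finA that] by simp
    then show "(?\<rho> d)\<^sup>2 \<le> (if d = 0 then (real (card A))\<^sup>2 else 0) + ?\<rho> d"
      by (auto simp: rep_zero power2_eq_square intro: mult_left_le)
  qed simp
  also have "\<dots> = real (CARD('a) ^ r) * ((real (card A))\<^sup>2 + (real (card A))\<^sup>2)"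
  proof -
    have "(\<Sum>d\<in>coords r. ?\<rho> d) = (real (card A))\<^sup>2"
      using assms(2) by (intro sum_rep finA finite_coords coords_diff) auto
    then show ?thesis
      using subspD(2)[OF subsp_coords, of r, where 'a = 'a] by (simp add: sum.distrib)
  qed
  finally show ?thesis by (simp add: mult_ac)
qed

end

section \<open>Averaging a Sidon set over cosets\<close>

context zero_sum_coefficients begin

lemma card_sols_trivial_le:
  assumes "finite A" "\<And>x. x \<in> sols A \<Longrightarrow> \<exists>a. \<forall>i<5. x i = a"
  shows "card (sols A) \<le> card A"
proof (rule card_inj_on_le)
  have PiE: "x \<in> PiE {..<5} (\<lambda>_. A)" if "x \<in> sols A" for x
    using that by (simp add: sols_def)
  show "(\<lambda>x. x 0) ` sols A \<subseteq> A"
    using PiE_mem[OF PiE, of _ 0] by auto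
  show "inj_on (\<lambda>x. x 0) (sols A)"
  proof (rule inj_onI)
    fix x y assume *: "x \<in> sols A" "y \<in> sols A" "x 0 = y 0"
    obtain a where a: "\<And>i. i < 5 \<Longrightarrow> x i = a" using assms(2)[OF *(1)] by blast
    obtain b where b: "\<And>i. i < 5 \<Longrightarrow> y i = b" using assms(2)[OF *(2)] by blast
    have "a = b" using a[of 0] b[of 0] *(3) by simp
    then show "x = y"
      using a b by (intro PiE_ext[OF PiE[OF *(1)] PiE[OF *(2)]]) simp
  qed
  show "finite A" by fact
qed

text \<open>The convolution of the indicators of \<open>A\<close> and \<open>W\<close>; for a
  subspace \<open>W\<close> it is the number of points of \<open>A\<close> in the coset of
  \<open>x\<close>. It is not divided by \<open>card W\<close>, which accounts for the powers of
  \<open>card W\<close> below.\<close>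

definition coset_count :: "(nat \<Rightarrow> 'a) set \<Rightarrow> (nat \<Rightarrow> 'a) set \<Rightarrow> (nat \<Rightarrow> 'a) \<Rightarrow> real" where
  "coset_count A W x = (\<Sum>a\<in>A. indicator W (x - a))"

lemma sum_indicator_coords:
  assumes "W \<subseteq> (coords r :: (nat \<Rightarrow> 'a) set)"
  shows "(\<Sum>x\<in>coords r. (indicator W x :: real)) = real (card W)"
  unfolding sum_indicator_square_coords[OF assms, symmetric]
  by (intro sum.cong refl) (simp add: indicator_def)

lemma sum_coset_count:
  assumes "A \<subseteq> coords r" "W \<subseteq> coords r"
  shows "(\<Sum>x\<in>coords r. coset_count A W x) = real (card A) * real (card W)"
proof -
  have "(\<Sum>x\<in>coords r. coset_count A W x) = (\<Sum>a\<in>A. \<Sum>x\<in>coords r. indicator W (x - a))"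
    unfolding coset_count_def by (rule sum.swap)
  also have "\<dots> = (\<Sum>a\<in>A. \<Sum>x\<in>coords r. indicator W x)"
    using assms(1) by (intro sum.cong refl sum_coords_shift) auto
  finally show ?thesis
    using sum_indicator_coords[OF assms(2)] by simp
qed

text \<open>The transform of a convolution is a product, and that of the indicator of
  \<open>W\<close> is \<open>card W\<close> on the annihilator and 0 elsewhere. Averaging thus keeps
  just the frequencies in \<open>annih r W\<close>.\<close>

lemma ft_coset_count:
  assumes "A \<subseteq> coords r" "subsp r W" "\<xi> \<in> coords r"
  shows "ft r (coset_count A W) \<xi> = (if \<xi> \<in> annih r W then of_nat (card W) * ft r (indicator A) \<xi> else 0)"
proof -
  have W: "W \<subseteq> coords r" using subspD[OF assms(2)] by auto
  have "ft r (coset_count A W) \<xi> = (\<Sum>x\<in>coords r. \<Sum>a\<in>A. of_real (indicator W (x - a)) * \<chi> (dot r \<xi> x))"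
    unfolding ft_def coset_count_def by (simp add: sum_distrib_right)
  also have "\<dots> = (\<Sum>a\<in>A. \<Sum>x\<in>coords r. of_real (indicator W (x - a)) * \<chi> (dot r \<xi> x))"
    by (rule sum.swap)
  also have "\<dots> = (\<Sum>a\<in>A. \<Sum>x\<in>coords r. of_real (indicator W (x - a)) * \<chi> (dot r \<xi> ((x - a) + a)))"
    by simp
  also have "\<dots> = (\<Sum>a\<in>A. \<Sum>x\<in>coords r. of_real (indicator W x) * \<chi> (dot r \<xi> (x + a)))"
    using assms(1) by (intro sum.cong refl sum_coords_shift[where F = "\<lambda>x. of_real (indicator W x) * \<chi> (dot r \<xi> (x + _))"]) auto
  also have "\<dots> = (\<Sum>a\<in>A. \<chi> (dot r \<xi> a) * ft r (indicator W) \<xi>)"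
    unfolding ft_def by (simp add: dot_add_right chi_add sum_distrib_left mult_ac)
  also have "\<dots> = ft r (indicator A) \<xi> * ft r (indicator W) \<xi>"
    by (simp add: ft_indicator[OF assms(1)] sum_distrib_right)
  finally show ?thesis
    using assms(3) by (auto simp: ft_indicator[OF W] sum_chi_subsp[OF assms(2)] annih_def)
qed

text \<open>The sum counts pairs from \<open>A\<close> lying in a common coset, each for
  \<open>card W\<close> values of \<open>x\<close>. By the Sidon property at most
  \<open>card A + card W\<close> pairs have their difference in \<open>W\<close>.\<close>

lemma sum_coset_count_square_le:
  assumes "sidon A" "A \<subseteq> coords r" "subsp r W"
  shows "(\<Sum>x\<in>coords r. (coset_count A W x)\<^sup>2) \<le> real (card W) * (real (card A) + real (card W))"
proof -
  have W: "W \<subseteq> coords r" using subspD[OF assms(3)] by auto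
  have finA: "finite A" using finite_subset[OF assms(2)] by simp
  have finW: "finite W" using finite_subset[OF W] by simp
  have "(\<Sum>x\<in>coords r. (coset_count A W x)\<^sup>2)
    = (\<Sum>x\<in>coords r. \<Sum>p\<in>A \<times> A. indicator W (x - fst p) * indicator W (x - snd p))"
    unfolding coset_count_def power2_eq_square sum_product sum.cartesian_product by (simp add: split_def)
  also have "\<dots> = (\<Sum>p\<in>A \<times> A. \<Sum>x\<in>coords r. indicator W (x - fst p) * indicator W (x - snd p))"
    by (rule sum.swap)
  also have "\<dots> \<le> (\<Sum>p\<in>A \<times> A. if fst p - snd p \<in> W then real (card W) else 0)"
  proof (rule sum_mono)
    fix p assume p: "p \<in> A \<times> A"
    have "indicator W (x - fst p) * indicator W (x - snd p)
        \<le> (if fst p - snd p \<in> W then indicator W (x - fst p) else (0::real))" for x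
    proof (cases "x - fst p \<in> W \<and> x - snd p \<in> W")
      case True
      then have "(x - snd p) - (x - fst p) \<in> W" using subspD(5)[OF assms(3)] by blast
      then show ?thesis using True by (simp add: indicator_def)
    qed (auto simp: indicator_def)
    then have "(\<Sum>x\<in>coords r. indicator W (x - fst p) * indicator W (x - snd p))
        \<le> (\<Sum>x\<in>coords r. if fst p - snd p \<in> W then indicator W (x - fst p) else (0::real))"
      by (rule sum_mono)
    also have "\<dots> = (if fst p - snd p \<in> W then \<Sum>x\<in>coords r. indicator W (x - fst p) else 0)"
      by simp
    also have "(\<Sum>x\<in>coords r. indicator W (x - fst p) :: real) = (\<Sum>x\<in>coords r. indicator W x)"
      using p assms(2) by (intro sum_coords_shift) auto
    finally show "(\<Sum>x\<in>coords r. indicator W (x - fst p) * indicator W (x - snd p))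
        \<le> (if fst p - snd p \<in> W then real (card W) else 0)"
      unfolding sum_indicator_coords[OF W] .
  qed
  also have "\<dots> = real (card W) * real (card {p \<in> A \<times> A. fst p - snd p \<in> W})"
    using finA by (simp add: sum.If_cases Int_def)
  also have "card {p \<in> A \<times> A. fst p - snd p \<in> W} = (\<Sum>d\<in>W. rep A d)"
  proof -
    have "{p. p \<in> {p \<in> A \<times> A. fst p - snd p \<in> W} \<and> fst p - snd p = d} = {p \<in> A \<times> A. fst p - snd p = d}"
      if "d \<in> W" for d using that by auto
    then show ?thesis
      using sum.group[of "{p \<in> A \<times> A. fst p - snd p \<in> W}" W "\<lambda>p. fst p - snd p" "\<lambda>_. 1 :: nat"] finA finW
      unfolding rep_def by (auto simp: image_subset_iff)
  qed
  also have "real (\<Sum>d\<in>W. rep A d) \<le> real (card A) + real (card W)"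
    using sum_rep_le[OF assms(1) finA finW] by simp
  finally show ?thesis by (simp add: mult_left_mono)
qed

text \<open>Every coefficient above \<open>d\<close> sits at a frequency in
  \<open>annih r W\<close>, where averaging only multiplies by \<open>card W\<close>. So the
  weighted count differs from \<open>card W ^ 5 * card (sols A)\<close> only through small
  coefficients, which the fourth moment controls; \<open>A\<close> itself has at most
  \<open>card A\<close> solutions.\<close>

lemma weighted_sols_coset_count_le:
  assumes "sidon A" "A \<subseteq> coords r" "\<And>x. x \<in> sols A \<Longrightarrow> \<exists>a. \<forall>i<5. x i = a"
    and "0 \<le> d"
    and W: "W = annih r {\<xi> \<in> coords r. d < norm (ft r (indicator A) \<xi>)}"
  shows "weighted_sols r (coset_count A W)
    \<le> real (card W) ^ 5 * (real (card A) + 10 * d * (real (card A))\<^sup>2)"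
proof -
  define N n w where "N = real (CARD('a) ^ r)" and "n = real (card A)" and "w = real (card W)"
  let ?S = "{\<xi> \<in> coords r. d < norm (ft r (indicator A) \<xi>)}"
  have N: "N > 0" unfolding N_def by simp
  have w: "w \<ge> 0" unfolding w_def by simp
  have finA: "finite A" using finite_subset[OF assms(2)] by simp
  have subW: "subsp r W" unfolding W by (rule subsp_annih)
  have S_annih: "\<xi> \<in> annih r W" if "\<xi> \<in> coords r" "d < norm (ft r (indicator A) \<xi>)" for \<xi>
    using that unfolding W annih_def by (auto simp: dot_commute[of r \<xi>])
  let ?F = "\<lambda>g \<xi>. \<Prod>i<5. ft r g (scl (\<alpha> i) \<xi>)"
  have F1: "?F (coset_count A W) \<xi> = of_real (w ^ 5) * ?F (indicator A) \<xi>" if "\<xi> \<in> annih r W" for \<xi>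
  proof -
    have "\<xi> \<in> coords r" using that by (simp add: annih_def)
    then have "ft r (coset_count A W) (scl (\<alpha> i) \<xi>) = of_real w * ft r (indicator A) (scl (\<alpha> i) \<xi>)"
      if "i < 5" for i
      using that \<open>\<xi> \<in> annih r W\<close> alpha_nonzero[OF that]
      by (simp add: ft_coset_count[OF assms(2) subW] scl_in_annih_iff coords_scl w_def)
    then have "?F (coset_count A W) \<xi> = (\<Prod>i<5. of_real w * ft r (indicator A) (scl (\<alpha> i) \<xi>))"
      by (intro prod.cong) auto
    then show ?thesis by (simp add: prod.distrib)
  qed
  \<comment> \<open>Dilation preserves the complement of the annihilator, so the factor with index 0
    already vanishes.\<close>
  have F0: "?F (coset_count A W) \<xi> = 0" if "\<xi> \<in> coords r - annih r W" for \<xi>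
    using that alpha_nonzero[of 0]
    by (intro prod_zero bexI[of _ 0]) (auto simp: ft_coset_count[OF assms(2) subW] scl_in_annih_iff coords_scl)
  have split: "(\<Sum>\<xi>\<in>coords r. ?F g \<xi>) = (\<Sum>\<xi>\<in>coords r - annih r W. ?F g \<xi>) + (\<Sum>\<xi>\<in>annih r W. ?F g \<xi>)" for g
    by (rule sum.subset_diff) (auto simp: annih_def)
  have "complex_of_real (N * weighted_sols r (coset_count A W)) = (\<Sum>\<xi>\<in>annih r W. ?F (coset_count A W) \<xi>)"
    unfolding N_def weighted_sols_fourier split by (simp add: F0)
  also have "\<dots> = of_real (w ^ 5) * (\<Sum>\<xi>\<in>annih r W. ?F (indicator A) \<xi>)"
    by (simp add: F1 sum_distrib_left)
  also have "(\<Sum>\<xi>\<in>annih r W. ?F (indicator A) \<xi>)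
      = of_real (N * real (card (sols A))) - (\<Sum>\<xi>\<in>coords r - annih r W. ?F (indicator A) \<xi>)"
    using weighted_sols_fourier[of r "indicator A"] split[of "indicator A"]
    unfolding weighted_sols_indicator[OF assms(2)] N_def by simp
  finally have diff: "complex_of_real (w ^ 5 * (N * real (card (sols A))) - N * weighted_sols r (coset_count A W))
      = of_real (w ^ 5) * (\<Sum>\<xi>\<in>coords r - annih r W. ?F (indicator A) \<xi>)"
    by (simp add: right_diff_distrib)
  have "\<bar>w ^ 5 * (N * real (card (sols A))) - N * weighted_sols r (coset_count A W)\<bar>
      = w ^ 5 * norm (\<Sum>\<xi>\<in>coords r - annih r W. ?F (indicator A) \<xi>)"
    using arg_cong[OF diff, of norm] w unfolding norm_mult norm_of_real by simp
  also have "\<dots> \<le> w ^ 5 * (5 * d * (\<Sum>\<xi>\<in>coords r. norm (ft r (indicator A) \<xi>) ^ 4))"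
  proof (intro mult_left_mono norm_sum_prod_ft_le)
    fix \<xi> assume \<xi>: "\<xi> \<in> coords r - annih r W"
    then have "scl (\<alpha> 0) \<xi> \<in> coords r - annih r W"
      using alpha_nonzero[of 0] by (simp add: scl_in_annih_iff coords_scl)
    then show "norm (ft r (indicator A) (scl (\<alpha> 0) \<xi>)) \<le> d"
      using S_annih by force
  qed (use w \<open>0 \<le> d\<close> in auto)
  also have "\<dots> \<le> w ^ 5 * (5 * d * (2 * n\<^sup>2 * N))"
    unfolding n_def N_def using w \<open>0 \<le> d\<close>
    by (intro mult_left_mono sum_norm_ft_power4_le assms) auto
  also have "\<dots> = N * (w ^ 5 * (10 * d * n\<^sup>2))" by simp
  finally have "N * weighted_sols r (coset_count A W)
      \<le> N * (w ^ 5 * (real (card (sols A)) + 10 * d * n\<^sup>2))"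
    by (simp add: algebra_simps)
  then have "weighted_sols r (coset_count A W) \<le> w ^ 5 * (real (card (sols A)) + 10 * d * n\<^sup>2)"
    using N by (rule mult_left_le_imp_le)
  also have "\<dots> \<le> w ^ 5 * (n + 10 * d * n\<^sup>2)"
    using card_sols_trivial_le[OF finA assms(3)] w unfolding n_def by (intro mult_left_mono) auto
  finally show ?thesis unfolding w_def n_def .
qed

lemma weighted_sols_ge:
  assumes "B \<subseteq> coords r" "\<And>x. 0 \<le> g x" "\<And>x. x \<in> B \<Longrightarrow> m \<le> g x" "0 \<le> m"
  shows "m ^ 5 * real (card (sols B)) \<le> weighted_sols r g"
proof -
  have "m ^ 5 * real (card (sols B)) = (\<Sum>x\<in>sols B. \<Prod>i<5::nat. m)" by simp
  also have "\<dots> \<le> (\<Sum>x\<in>sols B. \<Prod>i<5. g (x i))"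
    using assms(3,4) by (intro sum_mono prod_mono) (auto simp: sols_def)
  also have "\<dots> \<le> weighted_sols r g"
    unfolding weighted_sols_def using assms(1,2)
    by (intro sum_mono2 finite_sols) (auto simp: sols_def intro!: prod_nonneg)
  finally show ?thesis .
qed

text \<open>A Paley-Zygmund argument. The threshold is half of the mean, so points outside
  \<open>B\<close> carry at most half of the total; Cauchy-Schwarz on \<open>B\<close> and the
  second moment, at most \<open>2 * (card W)^2\<close>, bound \<open>card B\<close> from
  below.\<close>

lemma card_large_coset_count:
  assumes "sidon A" "A \<subseteq> coords r" "subsp r W" "card A \<le> card W"
    and B: "B = {x \<in> coords r. real (card A) * real (card W) / (2 * real (CARD('a) ^ r)) \<le> coset_count A W x}"
  shows "(real (card A))\<^sup>2 / 8 \<le> real (card B)"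
proof -
  define N n w where "N = real (CARD('a) ^ r)" and "n = real (card A)" and "w = real (card W)"
  define H where "H = coset_count A W"
  have N: "N > 0" unfolding N_def by simp
  have W: "W \<subseteq> coords r" "0 \<in> W" using subspD[OF assms(3)] by auto
  have w: "w > 0" using W(2) finite_subsp[OF assms(3)] unfolding w_def by (auto simp: card_gt_0_iff)
  have n: "n \<ge> 0" "n \<le> w" using assms(4) unfolding n_def w_def by auto
  have H0: "H x \<ge> 0" for x unfolding H_def coset_count_def by (simp add: sum_nonneg)
  have Bsub: "B \<subseteq> coords r" unfolding B by blast
  have "n * w = (\<Sum>x\<in>coords r. H x)"
    unfolding H_def n_def w_def sum_coset_count[OF assms(2) W(1)] ..
  also have "\<dots> = (\<Sum>x\<in>coords r - B. H x) + (\<Sum>x\<in>B. H x)"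
    by (rule sum.subset_diff[OF Bsub]) simp
  also have "(\<Sum>x\<in>coords r - B. H x) \<le> (\<Sum>x\<in>coords r - B. n * w / (2 * N))"
    unfolding B N_def n_def w_def H_def by (intro sum_mono) auto
  also have "\<dots> \<le> (\<Sum>x\<in>(coords r :: (nat \<Rightarrow> 'a) set). n * w / (2 * N))"
    using n w N by (intro sum_mono2) auto
  also have "\<dots> = n * w / 2"
    using N unfolding N_def by (simp add: card_coords)
  finally have "n * w / 2 \<le> (\<Sum>x\<in>B. \<bar>H x\<bar> * \<bar>1\<bar>)" using H0 by simp
  also have "\<dots> \<le> L2_set H B * L2_set (\<lambda>_. 1) B"
    by (rule L2_set_mult_ineq)
  finally have "(n * w / 2)\<^sup>2 \<le> (L2_set H B * L2_set (\<lambda>_. 1) B)\<^sup>2"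
    using n w by (intro power_mono) auto
  also have "\<dots> = (\<Sum>x\<in>B. (H x)\<^sup>2) * real (card B)"
    by (simp add: L2_set_def power_mult_distrib sum_nonneg)
  also have "\<dots> \<le> (\<Sum>x\<in>coords r. (H x)\<^sup>2) * real (card B)"
    using Bsub by (intro mult_right_mono sum_mono2) auto
  also have "\<dots> \<le> (w * (n + w)) * real (card B)"
    unfolding H_def w_def n_def by (intro mult_right_mono sum_coset_count_square_le assms) auto
  also have "\<dots> \<le> (w * (w + w)) * real (card B)"
    using n w by (intro mult_right_mono mult_left_mono) auto
  finally have "w\<^sup>2 * (n\<^sup>2 / 8) \<le> w\<^sup>2 * real (card B)"
    by (simp add: power2_eq_square field_simps)
  then show ?thesis using w unfolding n_def by simp
qed

text \<open>The threshold \<open>n0\<close> depends on \<epsilon> and the coefficients but not on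
  \<open>r\<close>. This uniformity allows the codimension of a code to vary with its
  length.\<close>

theorem card_sidon_eventually_less:
  assumes "0 < \<epsilon>"
  shows "\<exists>n0. \<forall>r A. A \<subseteq> coords r \<longrightarrow> sidon A \<longrightarrow> (\<forall>x\<in>sols A. \<exists>a. \<forall>i<5. x i = a) \<longrightarrow>
    n0 \<le> card A \<longrightarrow> (real (card A))\<^sup>2 < \<epsilon> * real (CARD('a) ^ r)"
proof -
  obtain c where c: "c > 0" and dense:
    "\<And>r U B. subsp r U \<Longrightarrow> B \<subseteq> U \<Longrightarrow> \<epsilon> / 8 * real (card U) \<le> real (card B) \<Longrightarrow>
      c * real (card U) ^ 4 \<le> real (card (sols B))"
    using card_sols_lower_bound[of "\<epsilon> / 8"] assms by auto
  \<comment> \<open>Chosen so that the error \<open>10 * \<delta> * n ^ 3\<close> is half of the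
    main term \<open>c * \<epsilon> / 32 * n ^ 3\<close>.\<close>
  define \<delta> where "\<delta> = c * \<epsilon> / 640"
  have \<delta>: "\<delta> > 0" unfolding \<delta>_def using c assms by simp
  \<comment> \<open>Bounds the number of coefficients exceeding \<open>\<delta> * n\<close>, by the
    fourth moment.\<close>
  define K where "K = nat \<lceil>2 / (\<epsilon> * \<delta> ^ 4)\<rceil>"
  \<comment> \<open>The first two summands give \<open>CARD('a) ^ K \<le> n - 1\<close>, which
    yields \<open>n \<le> card W\<close>; the last makes the \<open>n\<close> constant solutions
    negligible.\<close>
  define n0 where "n0 = CARD('a) ^ K + 1 + nat \<lceil>64 / (c * \<epsilon>)\<rceil>"
  have "(real (card A))\<^sup>2 < \<epsilon> * real (CARD('a) ^ r)"
    if A: "A \<subseteq> coords r" "sidon A" "\<forall>x\<in>sols A. \<exists>a. \<forall>i<5. x i = a" "n0 \<le> card A" for r and A :: "(nat \<Rightarrow> 'a) set"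
  proof (rule ccontr)
    assume contra: "\<not> ?thesis"
    define N n where "N = real (CARD('a) ^ r)" and "n = real (card A)"
    have finA: "finite A" using finite_subset[OF A(1)] by simp
    have N: "N > 0" unfolding N_def by simp
    have eN: "\<epsilon> * N \<le> n\<^sup>2" using contra unfolding N_def n_def by simp
    have n_ge: "real (CARD('a) ^ K) + 1 + 64 / (c * \<epsilon>) \<le> n"
      using A(4) unfolding n0_def n_def by linarith
    have diff_gt_zero: "0 < n - 1" and n1: "n \<ge> 1" and n2: "n > 64 / (c * \<epsilon>)" and n3: "real (CARD('a) ^ K) + 1 \<le> n"
    proof -
      have "real (CARD('a) ^ K) > 0" "64 / (c * \<epsilon>) > 0" using c assms by simp_all
      then show "0 < n - 1" "n \<ge> 1" "n > 64 / (c * \<epsilon>)" "real (CARD('a) ^ K) + 1 \<le> n"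
        using n_ge by linarith+
    qed
    define S where "S = {\<xi> \<in> coords r. \<delta> * n < norm (ft r (indicator A) \<xi>)}"
    define W where "W = annih r S"
    define w where "w = real (card W)"
    have finS: "finite S" unfolding S_def by simp
    have subW: "subsp r W" unfolding W_def by (rule subsp_annih)
    have "real (card S) * (\<delta> * n) ^ 4 = (\<Sum>\<xi>\<in>S. (\<delta> * n) ^ 4)" by simp
    also have "\<dots> \<le> (\<Sum>\<xi>\<in>S. norm (ft r (indicator A) \<xi>) ^ 4)"
      using \<delta> n1 by (intro sum_mono power_mono) (auto simp: S_def)
    also have "\<dots> \<le> (\<Sum>\<xi>\<in>coords r. norm (ft r (indicator A) \<xi>) ^ 4)"
      by (intro sum_mono2) (auto simp: S_def)
    also have "\<dots> \<le> 2 * n\<^sup>2 * N"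
      unfolding n_def N_def by (intro sum_norm_ft_power4_le A)
    also have "\<dots> \<le> 2 * n\<^sup>2 * (n\<^sup>2 / \<epsilon>)"
      using eN assms by (intro mult_left_mono) (auto simp: field_simps)
    finally have "real (card S) * \<delta> ^ 4 * n ^ 4 \<le> 2 / \<epsilon> * n ^ 4"
      by (simp add: power_mult_distrib power2_eq_square eval_nat_numeral mult_ac)
    then have "real (card S) * \<delta> ^ 4 \<le> 2 / \<epsilon>"
      by (rule mult_right_le_imp_le) (use n1 in simp)
    then have "real (card S) \<le> 2 / (\<epsilon> * \<delta> ^ 4)"
      using \<delta> assms by (simp add: field_simps)
    then have "card S \<le> K" unfolding K_def by linarith
    then have "CARD('a) ^ card S \<le> CARD('a) ^ K" by (intro power_increasing) auto
    then have "CARD('a) ^ r \<le> card W * CARD('a) ^ K"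
      unfolding W_def using card_annih_lower[OF finS, of r] by (meson le_trans mult_le_mono2)
    then have "N \<le> w * real (CARD('a) ^ K)"
      unfolding N_def w_def by (metis of_nat_le_iff of_nat_mult)
    \<comment> \<open>The Sidon property bounds the \<open>n^2\<close> ordered pairs by
      \<open>n\<close> plus the number of possible differences.\<close>
    moreover have "n\<^sup>2 \<le> n + N"
      using sum_rep[OF finA finite_coords, of r] sum_rep_le[OF A(2) finA finite_coords, of r] A(1)
      unfolding n_def N_def by (auto simp: card_coords subset_iff coords_diff)
    ultimately have "n * (n - 1) \<le> w * real (CARD('a) ^ K)"
      by (simp add: power2_eq_square algebra_simps)
    also have "\<dots> \<le> w * (n - 1)"
      using n3 unfolding w_def by (intro mult_left_mono) auto
    finally have "n \<le> w"
    proof (rule mult_right_le_imp_le)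
      show "0 < n - 1" by (rule diff_gt_zero)
    qed
    then have nw: "card A \<le> card W" unfolding n_def w_def by simp
    have w: "w > 0" using \<open>n \<le> w\<close> n1 by linarith
    define m where "m = n * w / (2 * N)"
    define B where "B = {x \<in> coords r. m \<le> coset_count A W x}"
    have m: "m > 0" unfolding m_def using n1 w N by simp
    have Bsub: "B \<subseteq> coords r" unfolding B_def by blast
    have "n\<^sup>2 / 8 \<le> real (card B)"
      unfolding n_def by (rule card_large_coset_count[OF A(2,1) subW nw])
        (simp add: B_def m_def n_def w_def N_def)
    then have "\<epsilon> / 8 * real (card (coords r :: (nat \<Rightarrow> 'a) set)) \<le> real (card B)"
      using eN unfolding N_def card_coords by simp
    from dense[OF subsp_coords Bsub this] have "c * N ^ 4 \<le> real (card (sols B))"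
      unfolding N_def card_coords .
    then have "m ^ 5 * (c * N ^ 4) \<le> m ^ 5 * real (card (sols B))"
      using m by (intro mult_left_mono) auto
    also have "\<dots> \<le> weighted_sols r (coset_count A W)"
      using m by (intro weighted_sols_ge Bsub)
        (auto simp: B_def coset_count_def intro!: sum_nonneg)
    also have "\<dots> \<le> w ^ 5 * (n + 10 * (\<delta> * n) * n\<^sup>2)"
      unfolding w_def n_def using A \<delta>
      by (intro weighted_sols_coset_count_le) (auto simp: W_def S_def n_def)
    \<comment> \<open>The \<open>w ^ 5\<close> hidden in \<open>m ^ 5\<close> matches the factor on
      the right and cancels.\<close>
    also have "m ^ 5 * (c * N ^ 4) = w ^ 5 * (c * n ^ 5 / (32 * N))"
      unfolding m_def using N by (simp add: field_simps eval_nat_numeral)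
    finally have "c * n ^ 5 / (32 * N) \<le> n + 10 * (\<delta> * n) * n\<^sup>2"
      by (rule mult_left_le_imp_le) (use w in simp)
    then have *: "c * n ^ 5 / (32 * N) \<le> n + 10 * \<delta> * n ^ 3"
      by (simp add: power3_eq_cube power2_eq_square mult_ac)
    \<comment> \<open>The assumption \<open>\<epsilon> * N \<le> n^2\<close> now enters as an upper
      bound for \<open>N\<close>, giving a main term of order \<open>n ^ 3\<close>.\<close>
    have "c * \<epsilon> / 32 * n ^ 3 = c * n ^ 5 / (32 * (n\<^sup>2 / \<epsilon>))"
      using n1 assms by (simp add: field_simps eval_nat_numeral)
    also have "\<dots> \<le> c * n ^ 5 / (32 * N)"
      using eN assms c n1 N by (intro divide_left_mono mult_left_mono) (auto simp: field_simps)
    also note *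
    finally have "c * \<epsilon> / 32 * n ^ 3 \<le> n + c * \<epsilon> / 64 * n ^ 3"
      unfolding \<delta>_def by simp
    then have "n * (c * \<epsilon> * n\<^sup>2) \<le> n * 64"
      by (simp add: power3_eq_cube power2_eq_square algebra_simps)
    then have "c * \<epsilon> * n\<^sup>2 \<le> 64" using n1 by simp
    moreover have "64 < c * \<epsilon> * n" using n2 c assms by (simp add: field_simps)
    moreover have "c * \<epsilon> * n \<le> c * \<epsilon> * n\<^sup>2"
      using n1 c assms by (intro mult_left_mono) (auto simp: power2_eq_square)
    ultimately show False by linarith
  qed
  then show ?thesis by blast
qed

end

section \<open>Codes and their parity check columns\<close>

text \<open>Vectors correspond to families of coefficients on a basis. A finite carrier is a finite
  spanning set, so a finite basis exists.\<close>

lemma (in vectorspace) card_carrier_eq_power_dim: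
  assumes "finite (carrier V)"
  shows "card (carrier V) = card (carrier K) ^ dim"
proof -
  have "span (carrier V) = carrier V"
    using in_own_span[of "carrier V"] span_is_subset2[of "carrier V"] by auto
  with assms have fin_dim
    unfolding fin_dim_def by auto
  then obtain A where A: "finite A" "basis A"
    using finite_basis_exists by blast
  then have Ac: "A \<subseteq> carrier V" by (simp add: basis_def)
  have ex1: "\<exists>!a. a \<in> A \<rightarrow>\<^sub>E carrier K \<and> lincomb a A = v" if "v \<in> carrier V" for v
    using basis_criterion[OF A(1) Ac] A(2) that by blast
  have "bij_betw (\<lambda>a. lincomb a A) (A \<rightarrow>\<^sub>E carrier K) (carrier V)"
  proof (rule bij_betw_imageI)
    have closed: "lincomb a A \<in> carrier V" if "a \<in> A \<rightarrow>\<^sub>E carrier K" for a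
      using that Ac by (intro lincomb_closed) auto
    then show "inj_on (\<lambda>a. lincomb a A) (A \<rightarrow>\<^sub>E carrier K)"
      using ex1 by (intro inj_onI) blast
    show "(\<lambda>a. lincomb a A) ` (A \<rightarrow>\<^sub>E carrier K) = carrier V"
      using closed ex1 by blast
  qed
  then show ?thesis
    using bij_betw_same_card dim_basis[OF A] card_PiE[OF A(1), of "\<lambda>_. carrier K"] by fastforce
qed

section \<open>Parity checks\<close>

context additive_character begin

text \<open>Induction on the codimension \<open>r\<close>: adjoin a vector \<open>v\<close> outside
  \<open>C\<close>. By the double annihilator some \<eta> vanishes on \<open>C\<close> but not at
  \<open>v\<close>, and \<open>C\<close> is its kernel in the larger space, so \<eta> is the one
  additional check.\<close>

lemma exists_parity_checks:
  fixes C :: "(nat \<Rightarrow> 'a) set"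
  assumes "subsp n C" "card C * CARD('a) ^ r = CARD('a) ^ n"
  shows "\<exists>y. C = {x \<in> coords n. \<forall>i<r. dot n (y i) x = 0}"
  using assms
proof (induction r arbitrary: C)
  case 0
  then have "C = coords n"
    using subspD(1) by (intro card_subset_eq) (auto simp: card_coords)
  then show ?case by auto
next
  case (Suc r)
  note C = subspD[OF Suc.prems(1)]
  have finC: "finite C" by (rule finite_subsp[OF Suc.prems(1)])
  have "CARD('a) > 1"
    using card_mono[of UNIV "{0, 1 :: 'a}"] by simp
  then have "C \<noteq> coords n"
    using Suc.prems(2) by (auto simp: card_coords)
  then obtain v where v: "v \<in> coords n" "v \<notin> C" using C(1) by blast
  then have "v \<notin> annih n (annih n C)"
    using annih_annih[OF Suc.prems(1)] by simp
  then obtain \<eta> where \<eta>: "\<eta> \<in> annih n C" "dot n \<eta> v \<noteq> 0"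
    using v(1) by (auto simp: annih_def dot_commute[of n v])
  define C' where "C' = {c + scl t v | c t. c \<in> C}"
  have "subsp n C'"
    unfolding subsp_def
  proof (intro conjI ballI allI)
    show "C' \<subseteq> coords n"
      unfolding C'_def using C(1) v(1) by (auto intro!: coords_add coords_scl)
    show "0 \<in> C'"
      unfolding C'_def using C(2) by (intro CollectI exI[of _ 0]) (simp add: scl_def fun_eq_iff)
    fix x assume "x \<in> C'"
    then obtain c t where x: "x = c + scl t v" "c \<in> C" unfolding C'_def by blast
    {
      fix y assume "y \<in> C'"
      then obtain d s where y: "y = d + scl s v" "d \<in> C" unfolding C'_def by blast
      have "x + y = (c + d) + scl (t + s) v"
        unfolding x y by (simp add: fun_eq_iff algebra_simps)
      then show "x + y \<in> C'" unfolding C'_def using C(3)[OF x(2) y(2)] by blast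
    next
      fix s
      have "scl s x = scl s c + scl (s * t) v"
        unfolding x by (simp add: fun_eq_iff algebra_simps)
      then show "scl s x \<in> C'" unfolding C'_def using C(4)[OF x(2)] by blast
    }
  qed
  have vC': "v \<in> C'"
    unfolding C'_def using C(2) by (intro CollectI exI[of _ 0] exI[of _ 1]) simp
  have CC': "C = {x \<in> C'. dot n \<eta> x = 0}"
  proof (intro subset_antisym subsetI)
    fix x assume "x \<in> C"
    moreover have "x = x + scl 0 v" by (simp add: fun_eq_iff)
    ultimately have "x \<in> C'" unfolding C'_def by blast
    with \<open>x \<in> C\<close> show "x \<in> {x \<in> C'. dot n \<eta> x = 0}"
      using \<eta>(1) by (simp add: annih_def)
  next
    fix x assume "x \<in> {x \<in> C'. dot n \<eta> x = 0}"
    then obtain c t where x: "x = c + scl t v" "c \<in> C" "dot n \<eta> x = 0" unfolding C'_def by blast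
    have "t * dot n \<eta> v = 0"
      using x \<eta>(1) by (simp add: dot_add_right dot_scl_right annih_def)
    then have "t = 0" using \<eta>(2) by simp
    then have "x = c" using x(1) by (simp add: fun_eq_iff)
    then show "x \<in> C" using x(2) by simp
  qed
  have "card C' = CARD('a) * card C"
    unfolding CC' by (rule card_subsp_hyperplane(2)[OF \<open>subsp n C'\<close> vC' \<eta>(2)])
  then have "card C' * CARD('a) ^ r = CARD('a) ^ n"
    using Suc.prems(2) by (simp add: mult_ac)
  then obtain y where y: "C' = {x \<in> coords n. \<forall>i<r. dot n (y i) x = 0}"
    using Suc.IH[OF \<open>subsp n C'\<close>] by blast
  have "C = {x \<in> coords n. \<forall>i<Suc r. dot n ((y(r := \<eta>)) i) x = 0}"
    unfolding CC' y by (auto simp: less_Suc_eq)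
  then show ?case by blast
qed

end

context zero_sum_coefficients begin

text \<open>The points of \<open>A\<close> are the columns of a parity check matrix. A coincidence of two differences
  is a linear relation with at most four terms, and a solution of the equation is one with at most
  five.\<close>

lemma code_columns:
  fixes C :: "(nat \<Rightarrow> 'a) set"
  assumes C: "subsp n C" "card C * CARD('a) ^ r = CARD('a) ^ n"
    and weight: "\<And>x. x \<in> C \<Longrightarrow> card {j. x j \<noteq> 0} \<le> 5 \<Longrightarrow> x = 0"
    and two: "(2 :: 'a) \<noteq> 0"
    and zero_sum_free: "\<And>I. I \<subseteq> {..<5} \<Longrightarrow> I \<noteq> {} \<Longrightarrow> (\<Sum>i\<in>I. \<alpha> i) = 0 \<Longrightarrow> I = {..<5}"
  shows "\<exists>A. A \<subseteq> coords r \<and> card A = n \<and> sidon A \<and> (\<forall>x\<in>sols A. \<exists>a. \<forall>i<5. x i = a)"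
proof -
  obtain y where y: "C = {x \<in> coords n. \<forall>i<r. dot n (y i) x = 0}"
    using exists_parity_checks[OF C] by blast
  \<comment> \<open>Column \<open>j\<close> of the parity check matrix, padded with zeros beyond its
    \<open>r\<close> entries.\<close>
  define a where "a j = (\<lambda>i. if i < r then y i j else 0)" for j
  have indep: "x = 0" if "finite J" "J \<subseteq> {..<n}" "card J \<le> 5" "\<And>j. j \<notin> J \<Longrightarrow> x j = 0"
    "\<And>i. (\<Sum>j\<in>J. x j * a j i) = 0" for x J
  proof (rule weight)
    have "dot n (y i) x = 0" if "i < r" for i
    proof -
      have "dot n (y i) x = (\<Sum>j<n. x j * a j i)"
        using that unfolding dot_def a_def by (simp add: mult.commute)
      also have "\<dots> = (\<Sum>j\<in>J. x j * a j i)"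
        using \<open>J \<subseteq> {..<n}\<close> \<open>\<And>j. j \<notin> J \<Longrightarrow> x j = 0\<close> by (intro sum.mono_neutral_right) auto
      finally show ?thesis using that(1) \<open>\<And>i. (\<Sum>j\<in>J. x j * a j i) = 0\<close> by simp
    qed
    moreover have "x \<in> coords n"
      unfolding coords_def
    proof (intro CollectI allI impI)
      fix i assume "n \<le> i"
      then have "i \<notin> J" using that(2) by auto
      then show "x i = 0" by (rule that(4))
    qed
    ultimately show "x \<in> C" unfolding y by blast
    have "card {j. x j \<noteq> 0} \<le> card J"
      using that(4) by (intro card_mono that(1)) blast
    then show "card {j. x j \<noteq> 0} \<le> 5" using that(3) by linarith
  qed
  \<comment> \<open>The indices \<open>J m\<close> may repeat. Collecting coefficients by index
    gives a codeword of weight at most 5, hence 0; the claim is its entry at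
    \<open>J 0\<close>.\<close>
  have relation: "(\<Sum>m | m < l \<and> J m = J 0. c m) = 0"
    if J: "\<And>m. m < l \<Longrightarrow> J m < n" and "0 < l" "l \<le> 5" and rel: "\<And>i. (\<Sum>m<l. c m * a (J m) i) = 0"
    for l :: nat and J :: "nat \<Rightarrow> nat" and c :: "nat \<Rightarrow> 'a"
  proof -
    define x where "x j = (\<Sum>m | m < l \<and> J m = j. c m)" for j
    have "x = 0"
    proof (rule indep[of "J ` {..<l}"])
      show "card (J ` {..<l}) \<le> 5"
        using card_image_le[of "{..<l}" J] \<open>l \<le> 5\<close> by simp
      fix i
      have "(\<Sum>j\<in>J ` {..<l}. x j * a j i) = (\<Sum>j\<in>J ` {..<l}. \<Sum>m\<in>{m \<in> {..<l}. J m = j}. c m * a (J m) i)"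
        unfolding x_def sum_distrib_right by (intro sum.cong) auto
      also have "\<dots> = (\<Sum>m<l. c m * a (J m) i)"
        by (rule sum.group) auto
      finally show "(\<Sum>j\<in>J ` {..<l}. x j * a j i) = 0" using rel by simp
    next
      fix j assume "j \<notin> J ` {..<l}"
      then have "{m. m < l \<and> J m = j} = {}" by auto
      then show "x j = 0" unfolding x_def by (simp only: sum.empty)
    qed (use J in auto)
    then show ?thesis unfolding x_def by (simp add: fun_eq_iff)
  qed
  have inj: "inj_on a {..<n}"
  proof (rule inj_onI, rule ccontr)
    fix j k assume "j \<in> {..<n}" "k \<in> {..<n}" "a j = a k" "j \<noteq> k"
    have "(\<Sum>m | m < 2 \<and> [j, k] ! m = [j, k] ! 0. [1, - 1 :: 'a] ! m) = 0"
    proof (rule relation)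
      show "[j, k] ! m < n" if "m < 2" for m
        using that \<open>j \<in> {..<n}\<close> \<open>k \<in> {..<n}\<close> by (auto simp: less_2_cases_iff)
      show "(\<Sum>m<2. [1, - 1] ! m * a ([j, k] ! m) i) = 0" for i
        using \<open>a j = a k\<close> by (simp add: lessThan_nat_numeral)
    qed auto
    moreover have "{m. m < 2 \<and> [j, k] ! m = [j, k] ! 0} = {0 :: nat}"
      using \<open>j \<noteq> k\<close> by (auto simp: less_2_cases_iff)
    ultimately show False by simp
  qed
  define A where "A = a ` {..<n}"
  have "sidon A"
    unfolding sidon_def A_def
  proof (safe, rule ccontr)
    fix j k l m
    assume less: "j < n" "k < n" "l < n" "m < n" and eq: "a j - a k = a l - a m"
      and "a j \<noteq> a k" "a j \<noteq> a l"
    then have ne: "j \<noteq> k" "j \<noteq> l" by auto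
    define J where "J = (!) [j, k, l, m]"
    define c where "c = (!) [1, - 1, - 1, 1 :: 'a]"
    have four: "{..<4::nat} = {0, 1, 2, 3}" by auto
    have "(\<Sum>i | i < 4 \<and> J i = J 0. c i) = 0"
    proof (intro relation)
      show "J i < n" if "i < 4" for i
      proof -
        have "i \<in> {..<4}" using that by simp
        then show ?thesis unfolding four J_def using less by auto
      qed
      show "(\<Sum>i<4. c i * a (J i) h) = 0" for h
      proof -
        have "(\<Sum>i<4. c i * a (J i) h) = (a j h - a k h) - (a l h - a m h)"
          unfolding four by (simp add: J_def c_def algebra_simps)
        then show ?thesis using fun_cong[OF eq, of h] by simp
      qed
    qed auto
    moreover have "{i. i < 4 \<and> J i = J 0} = {i \<in> {..<4}. J i = J 0}" by auto
    \<comment> \<open>Index \<open>j\<close> differs from \<open>k\<close> and \<open>l\<close>, so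
      it can coincide only with \<open>m\<close>. The collected coefficient is then 1 or 2, both
      nonzero.\<close>
    moreover have "{i \<in> {..<4}. J i = J 0} = (if m = j then {0, 3} else {0})"
      unfolding four J_def using ne by auto
    ultimately have "(\<Sum>i\<in>(if m = j then {0, 3} else {0}). c i) = 0" by (simp only:)
    then show False
      using two by (cases "m = j") (simp_all add: c_def)
  qed
  moreover have "\<exists>b. \<forall>i<5. x i = b" if x: "x \<in> sols A" for x
  proof -
    have "\<forall>i<5. \<exists>j<n. x i = a j"
      using x unfolding sols_def A_def by (auto simp: PiE_def Pi_def)
    then obtain J where J: "\<And>i. i < 5 \<Longrightarrow> J i < n" "\<And>i. i < 5 \<Longrightarrow> x i = a (J i)" by metis
    have "(\<Sum>m<5. \<alpha> m * a (J m) i) = 0" for i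
      using x J(2) fun_cong[of "comb x" 0 i] unfolding sols_def comb_def by simp
    then have "(\<Sum>m | m < 5 \<and> J m = J 0. \<alpha> m) = 0"
      using J by (intro relation) auto
    \<comment> \<open>The indices sharing the column of \<open>x 0\<close> form a nonempty set with
      vanishing coefficient sum, so they are all five.\<close>
    then have "{m. m < 5 \<and> J m = J 0} = {..<5}"
      by (intro zero_sum_free) (auto intro!: exI[of _ 0])
    then have "J i = J 0" if "i < 5" for i
      using that by blast
    then show ?thesis using J(2) by metis
  qed
  moreover have "A \<subseteq> coords r" unfolding A_def a_def coords_def by auto
  moreover have "card A = n" unfolding A_def using card_image[OF inj] by simp
  ultimately show ?thesis by blast
qed

end

section \<open>Choice of the five coefficients\<close>

lemma of_nat_card_UNIV: "of_nat CARD('a) = (0 :: 'a::{field,finite})"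
proof -
  have "(\<Sum>x\<in>UNIV. x :: 'a) = (\<Sum>x\<in>UNIV. x + 1)"
    by (rule sum.reindex_bij_witness[of _ "\<lambda>x. x + 1" "\<lambda>x. x - 1"]) auto
  also have "\<dots> = (\<Sum>x\<in>UNIV. x) + of_nat CARD('a)"
    by (simp add: sum.distrib)
  finally show ?thesis by simp
qed

lemma CHAR_prime_power_card:
  assumes "CARD('a::{field,finite}) = p ^ m" "prime p"
  shows "CHAR('a) = p"
proof -
  have "of_nat p ^ m = (0 :: 'a)"
    using of_nat_card_UNIV[where 'a = 'a] assms(1) by simp
  then have "of_nat p = (0 :: 'a)" by simp
  then have "CHAR('a) dvd p" by (simp add: of_nat_eq_0_iff_char_dvd)
  moreover have "CHAR('a) \<noteq> 1" by simp
  ultimately show ?thesis using assms(2) by (meson prime_nat_iff)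
qed

text \<open>For \<open>p \<ge> 5\<close> the coefficients 1, 1, 1, 1, -4 work, because a subsum
  vanishes modulo \<open>p\<close> only if it vanishes over the integers. In characteristic 3 the
  field is larger than its prime field, and 1, 1, g, g, 1 + g work for any \<open>g\<close> outside
  that prime field.\<close>

lemma exists_zero_sum_free_coefficients:
  assumes "CHAR('a::{field,finite}) = p" "prime p" "odd p" "CARD('a) \<ge> 7"
  shows "\<exists>\<alpha> :: nat \<Rightarrow> 'a. (\<Sum>i<5. \<alpha> i) = 0 \<and> (\<forall>i<5. \<alpha> i \<noteq> 0) \<and>
    (\<forall>I\<subseteq>{..<5}. I \<noteq> {} \<longrightarrow> (\<Sum>i\<in>I. \<alpha> i) = 0 \<longrightarrow> I = {..<5})"
proof -
  have dvd: "of_nat k = (0 :: 'a) \<longleftrightarrow> p dvd k" for k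
    using assms(1) by (simp add: of_nat_eq_0_iff_char_dvd)
  have five: "{..<5::nat} = {0, 1, 2, 3, 4}" by auto
  \<comment> \<open>Membership as a natural number 0 or 1, so that subset sums become a matter of
    linear arithmetic.\<close>
  define b where "b I i = (if i \<in> I then 1 else 0 :: nat)" for I :: "nat set" and i
  have b: "b I i = 0 \<or> b I i = 1" for I i by (simp add: b_def)
  have le: "b I i \<le> 1" for I i by (simp add: b_def)
  have b1: "b I i = 1 \<longleftrightarrow> i \<in> I" and b0: "b I i = 0 \<longleftrightarrow> i \<notin> I" for I i
    by (simp_all add: b_def)
  have full: "I = {..<5}" if "I \<subseteq> {..<5}" "b I 0 = 1" "b I 1 = 1" "b I 2 = 1" "b I 3 = 1" "b I 4 = 1" for I
  proof -
    have "{0, 1, 2, 3, 4} \<subseteq> I" using that(2-) unfolding b1 by blast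
    with that(1) show ?thesis unfolding five by (rule subset_antisym)
  qed
  have empty: "I = {}" if "I \<subseteq> {..<5}" "b I 0 = 0" "b I 1 = 0" "b I 2 = 0" "b I 3 = 0" "b I 4 = 0" for I
  proof -
    have "i \<notin> I" if "i \<in> {0, 1, 2, 3, 4}" for i
      using that \<open>b I 0 = 0\<close> \<open>b I 1 = 0\<close> \<open>b I 2 = 0\<close> \<open>b I 3 = 0\<close> \<open>b I 4 = 0\<close>
      unfolding b0 by blast
    with that(1) show ?thesis unfolding five by blast
  qed
  have sum: "(\<Sum>i\<in>I. \<alpha> i) = of_nat (b I 0) * \<alpha> 0 + of_nat (b I 1) * \<alpha> 1 + of_nat (b I 2) * \<alpha> 2
      + of_nat (b I 3) * \<alpha> 3 + of_nat (b I 4) * \<alpha> 4"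
    if "I \<subseteq> {..<5}" for I and \<alpha> :: "nat \<Rightarrow> 'a"
  proof -
    have "(\<Sum>i\<in>I. \<alpha> i) = (\<Sum>i\<in>I. of_nat (b I i) * \<alpha> i)"
      by (intro sum.cong) (simp_all add: b_def)
    also have "\<dots> = (\<Sum>i<5. of_nat (b I i) * \<alpha> i)"
      using that by (intro sum.mono_neutral_left) (auto simp: b_def)
    finally show ?thesis unfolding five by (simp add: add.assoc)
  qed
  show ?thesis
  proof (cases "p = 3")
    case False
    have p5: "p \<ge> 5"
    proof (rule ccontr)
      assume "\<not> p \<ge> 5"
      then have "p \<in> {0, 1, 2, 4}" using False by auto
      then show False using assms(2,3) by auto
    qed
    define \<alpha> where "\<alpha> i = (if i = 4 then - of_nat 4 else 1 :: 'a)" for i :: nat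
    show ?thesis
    proof (intro exI[of _ \<alpha>] conjI allI impI)
      show "(\<Sum>i<5. \<alpha> i) = 0" unfolding five by (simp add: \<alpha>_def)
      show "\<alpha> i \<noteq> 0" for i
        using dvd[of 4] p5 by (auto simp: \<alpha>_def dest: dvd_imp_le)
      fix I assume I: "I \<subseteq> {..<5::nat}" "I \<noteq> {}" "(\<Sum>i\<in>I. \<alpha> i) = 0"
      define s where "s = b I 0 + b I 1 + b I 2 + b I 3"
      note le = le[of I 0] le[of I 1] le[of I 2] le[of I 3]
      have s: "s \<le> 4" unfolding s_def using le by linarith
      have eq: "of_nat s = (of_nat (4 * b I 4) :: 'a)"
        using I(3) unfolding sum[OF I(1)] s_def by (simp add: \<alpha>_def)
      show "I = {..<5}"
      proof (cases "b I 4 = 0")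
        case True
        then have "p dvd s" using eq dvd by simp
        then have "s = 0" using s p5 by (auto dest: dvd_imp_le)
        then show ?thesis using empty[OF I(1)] I(2) True unfolding s_def by simp
      next
        case False
        then have b4: "b I 4 = 1" using b[of I 4] by simp
        then have "of_nat (4 - s) = (0 :: 'a)" using eq s by (simp add: of_nat_diff)
        then have "p dvd 4 - s" using dvd by blast
        then have "4 - s = 0" using p5 by (auto dest: dvd_imp_le)
        then have "b I 0 = 1" "b I 1 = 1" "b I 2 = 1" "b I 3 = 1"
          using le unfolding s_def by linarith+
        then show ?thesis using full[OF I(1)] b4 by blast
      qed
    qed
  next
    case True
    have three: "(3 :: 'a) = 0" using dvd[of 3] True by simp
    have "\<not> UNIV \<subseteq> {0, 1, - 1 :: 'a}"
    proof
      assume "UNIV \<subseteq> {0, 1, - 1 :: 'a}"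
      then have "CARD('a) \<le> card {0, 1, - 1 :: 'a}" by (intro card_mono) auto
      also have "\<dots> \<le> 3" by (simp add: card_insert_if)
      finally show False using assms(4) by simp
    qed
    then obtain g :: 'a where g: "g \<noteq> 0" "g \<noteq> 1" "g \<noteq> - 1" by blast
    have g': "1 + g \<noteq> 0" using g(3) by (metis add_eq_0_iff)
    define \<alpha> where "\<alpha> = (!) [1, 1, g, g, 1 + g]"
    have two: "(2 :: 'a) = - 1" using three by (simp add: eq_neg_iff_add_eq_0)
    show ?thesis
    proof (intro exI[of _ \<alpha>] conjI allI impI)
      have "(\<Sum>i<5. \<alpha> i) = 3 * (1 + g)" unfolding five by (simp add: \<alpha>_def)
      then show "(\<Sum>i<5. \<alpha> i) = 0" using three by simp
      show "\<alpha> i \<noteq> 0" if "i < 5" for i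
      proof -
        have "i \<in> {..<5}" using that by simp
        then show ?thesis unfolding five using g g' by (auto simp: \<alpha>_def)
      qed
      fix I assume I: "I \<subseteq> {..<5::nat}" "I \<noteq> {}" "(\<Sum>i\<in>I. \<alpha> i) = 0"
      \<comment> \<open>The multiplicities of 1 and \<open>g\<close> in the subsum; index 4
        contributes to both.\<close>
      define s t where "s = b I 0 + b I 1 + b I 4" and "t = b I 2 + b I 3 + b I 4"
      have eq: "of_nat s + of_nat t * g = 0"
        using I(3) unfolding sum[OF I(1)] s_def t_def by (simp add: \<alpha>_def algebra_simps)
      note le = le[of I 0] le[of I 1] le[of I 2] le[of I 3] le[of I 4]
      have vals: "s = 0 \<or> s = 1 \<or> s = 2 \<or> s = 3" "t = 0 \<or> t = 1 \<or> t = 2 \<or> t = 3"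
        unfolding s_def t_def using le by linarith+
      have prime_field: "(of_nat s :: 'a) \<in> {0, 1, - 1}"
        using vals(1) by (auto simp: two three)
      \<comment> \<open>Otherwise \<open>t\<close> would be invertible modulo 3 and \<open>g\<close>
        would lie in the prime field.\<close>
      have "t = 0 \<or> t = 3"
      proof (rule ccontr)
        assume "\<not> ?thesis"
        then have "t = 1 \<or> t = 2" using vals(2) by auto
        then have "g = - of_nat s \<or> g = of_nat s"
          using eq by (auto simp: two eq_neg_iff_add_eq_0 add.commute)
        then show False using prime_field g by auto
      qed
      moreover from this have "of_nat s = (0 :: 'a)" using eq three by auto
      then have "s = 0 \<or> s = 3"
        using vals(1) dvd[of s] True by auto
      ultimately consider "s = 0" "t = 0" | "s = 3" "t = 3" | "s = 0" "t = 3" | "s = 3" "t = 0" by blast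
      then show "I = {..<5}"
      proof cases
        case 1
        then show ?thesis using empty[OF I(1)] I(2) unfolding s_def t_def by simp
      next
        case 2
        then have "b I 0 = 1" "b I 1 = 1" "b I 2 = 1" "b I 3 = 1" "b I 4 = 1"
          using le unfolding s_def t_def by linarith+
        then show ?thesis by (rule full[OF I(1)])
      \<comment> \<open>The mixed cases are impossible: one sum being 3 includes index 4, the other
        being 0 excludes it.\<close>
      qed (use le in \<open>unfold s_def t_def, linarith+\<close>)
    qed
  qed
qed

section \<open>From vectors to functions\<close>

definition fun_of_vec :: "nat \<Rightarrow> 'a::zero vec \<Rightarrow> nat \<Rightarrow> 'a" where
  "fun_of_vec n v = (\<lambda>i. if i < n then v $ i else 0)"

lemma inj_on_fun_of_vec: "inj_on (fun_of_vec n) (carrier_vec n)"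
proof (rule inj_onI)
  fix v w :: "'a vec"
  assume vw: "v \<in> carrier_vec n" "w \<in> carrier_vec n" and eq: "fun_of_vec n v = fun_of_vec n w"
  show "v = w"
  proof (rule eq_vecI)
    fix i assume "i < dim_vec w"
    then show "v $ i = w $ i"
      using fun_cong[OF eq, of i] vw by (simp add: fun_of_vec_def)
  qed (use vw in simp)
qed

text \<open>Transfers codes to the coordinate model: the dimension is recorded by cardinality, and
  the weight of a nonzero word is its distance to the zero word.\<close>

lemma linear_code_fun_of_vec:
  fixes C :: "'a::{field,finite} vec set"
  assumes "linear_code n k d C"
  shows "subsp n (fun_of_vec n ` C)" and "card (fun_of_vec n ` C) = CARD('a) ^ k"
    and "\<And>x. x \<in> fun_of_vec n ` C \<Longrightarrow> x \<noteq> 0 \<Longrightarrow> d \<le> card {i. x i \<noteq> 0}"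
proof -
  interpret V: vec_space "TYPE('a)" n .
  have sub: "VectorSpace.subspace class_ring C (module_vec TYPE('a) n)"
    and dim: "vectorspace.dim class_ring ((module_vec TYPE('a) n)\<lparr>carrier := C\<rparr>) = k"
    and dist: "has_min_distance C d"
    using assms by (auto simp: linear_code_def)
  interpret S: submodule class_ring C "module_vec TYPE('a) n"
    using sub by (simp add: VectorSpace.subspace_def)
  have Cc: "C \<subseteq> carrier_vec n"
    using S.subset by (simp add: module_vec_simps)
  have C0: "0\<^sub>v n \<in> C"
    using S.zero_closed by (simp add: module_vec_simps)
  have Cadd: "v + w \<in> C" if "v \<in> C" "w \<in> C" for v w
    using S.m_closed[OF that] by (simp add: module_vec_simps)
  have Csmult: "c \<cdot>\<^sub>v v \<in> C" if "v \<in> C" for c v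
    using S.smult_closed[OF _ that, of c] by (simp add: module_vec_simps class_ring_simps)
  have fov0: "fun_of_vec n (0\<^sub>v n) = (0 :: nat \<Rightarrow> 'a)"
    by (auto simp: fun_of_vec_def fun_eq_iff)
  show subsp: "subsp n (fun_of_vec n ` C)"
    unfolding subsp_def
  proof (intro conjI ballI allI)
    show "fun_of_vec n ` C \<subseteq> coords n" by (auto simp: fun_of_vec_def coords_def)
    show "0 \<in> fun_of_vec n ` C" using C0 fov0 by force
  next
    fix x y assume "x \<in> fun_of_vec n ` C" "y \<in> fun_of_vec n ` C"
    then obtain v w where vw: "v \<in> C" "w \<in> C" "x = fun_of_vec n v" "y = fun_of_vec n w" by blast
    then have "x + y = fun_of_vec n (v + w)"
      using Cc by (auto simp: fun_of_vec_def fun_eq_iff)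
    then show "x + y \<in> fun_of_vec n ` C" using Cadd vw by blast
  next
    fix c x assume "x \<in> fun_of_vec n ` C"
    then obtain v where v: "v \<in> C" "x = fun_of_vec n v" by blast
    then have "scl c x = fun_of_vec n (c \<cdot>\<^sub>v v)"
      using Cc by (auto simp: fun_of_vec_def fun_eq_iff)
    then show "scl c x \<in> fun_of_vec n ` C" using Csmult v by blast
  qed
  have card: "card (fun_of_vec n ` C) = card C"
    by (rule card_image) (rule inj_on_subset[OF inj_on_fun_of_vec Cc])
  have finC: "finite C"
    using finite_imageD[OF finite_subsp[OF subsp] inj_on_subset[OF inj_on_fun_of_vec Cc]] .
  interpret W: vectorspace class_ring "(module_vec TYPE('a) n)\<lparr>carrier := C\<rparr>"
    by (rule V.subspace_is_vs[OF sub])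
  have "card C = CARD('a) ^ k"
    using finC W.card_carrier_eq_power_dim dim by (simp add: class_ring_simps)
  then show "card (fun_of_vec n ` C) = CARD('a) ^ k" by (simp add: card)
  show "d \<le> card {i. x i \<noteq> 0}" if x: "x \<in> fun_of_vec n ` C" "x \<noteq> 0" for x
  proof -
    obtain v where v: "v \<in> C" "x = fun_of_vec n v" using x(1) by blast
    then have "v \<noteq> 0\<^sub>v n" using x(2) fov0 by auto
    then have "d \<le> hamming_dist v (0\<^sub>v n)"
      using dist v(1) C0 unfolding has_min_distance_def by blast
    moreover have "{i. i < dim_vec v \<and> v $ i \<noteq> 0\<^sub>v n $ i} = {i. x i \<noteq> 0}"
      using v Cc by (auto simp: fun_of_vec_def)
    ultimately show ?thesis by (simp add: hamming_dist_def)
  qed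
qed

section \<open>The asymptotic bound\<close>

lemma linear_code_dim_le:
  assumes "linear_code n k d (C :: 'a::{field,finite} vec set)"
  shows "k \<le> n"
proof -
  have "CARD('a) ^ k \<le> CARD('a) ^ n"
    using card_mono[OF finite_coords subspD(1)[OF linear_code_fun_of_vec(1)[OF assms]]]
    unfolding linear_code_fun_of_vec(2)[OF assms] card_coords .
  moreover have "CARD('a) > 1"
    using card_mono[of UNIV "{0, 1 :: 'a}"] by simp
  ultimately show ?thesis by (simp add: power_increasing_iff)
qed

lemma linear_code_6_eventually:
  fixes M :: real
  assumes "CARD('a::{field,finite}) = p ^ m" "prime p" "odd p" "CARD('a) \<ge> 7"
  shows "\<exists>n0. \<forall>n\<ge>n0. \<forall>k. \<forall>C :: 'a vec set. linear_code n k 6 C \<longrightarrow>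
    M \<le> real n - real k - 2 * log (real CARD('a)) (real n)"
proof -
  define q where "q = real CARD('a)"
  have q: "q > 1" using assms(4) unfolding q_def by simp
  have char: "CHAR('a) = p" by (rule CHAR_prime_power_card[OF assms(1,2)])
  have "\<not> p dvd 2"
  proof
    assume "p dvd 2"
    then have "p \<le> 2" by (rule dvd_imp_le) simp
    then have "p = 2" using prime_ge_2_nat[OF assms(2)] by simp
    then show False using assms(3) by simp
  qed
  then have two: "(2 :: 'a) \<noteq> 0"
    using of_nat_eq_0_iff_char_dvd[of 2, where 'a = 'a] char by simp
  obtain \<alpha> :: "nat \<Rightarrow> 'a" where \<alpha>: "(\<Sum>i<5. \<alpha> i) = 0" "\<And>i. i < 5 \<Longrightarrow> \<alpha> i \<noteq> 0"
    "\<And>I. I \<subseteq> {..<5} \<Longrightarrow> I \<noteq> {} \<Longrightarrow> (\<Sum>i\<in>I. \<alpha> i) = 0 \<Longrightarrow> I = {..<5}"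
    using exists_zero_sum_free_coefficients[OF char assms(2-4)] by blast
  obtain \<chi> :: "'a \<Rightarrow> complex" where "\<And>x y. \<chi> (x + y) = \<chi> x * \<chi> y" "\<And>x. norm (\<chi> x) = 1" "\<exists>x. \<chi> x \<noteq> 1"
    using exists_nontrivial_additive_character by blast
  then interpret zero_sum_coefficients \<chi> \<alpha>
    using \<alpha>(1,2) by unfold_locales
  \<comment> \<open>With \<epsilon> equal to \<open>q powr (- M)\<close>, taking logarithms of the
    bound turns it into a gap of at least \<open>M\<close>.\<close>
  obtain n0 where n0: "\<And>r A. A \<subseteq> coords r \<Longrightarrow> sidon A \<Longrightarrow> (\<forall>x\<in>sols A. \<exists>a. \<forall>i<5. x i = a) \<Longrightarrow>
      n0 \<le> card A \<Longrightarrow> (real (card A))\<^sup>2 < q powr (- M) * real (CARD('a) ^ r)"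
    using card_sidon_eventually_less[of "q powr (- M)"] q by auto
  have "M \<le> real n - real k - 2 * log q (real n)"
    if n: "n \<ge> max n0 1" and C: "linear_code n k 6 C" for n k and C :: "'a vec set"
  proof -
    note code = linear_code_fun_of_vec[OF C]
    have k: "k \<le> n" by (rule linear_code_dim_le[OF C])
    have weight: "x = 0" if "x \<in> fun_of_vec n ` C" "card {j. x j \<noteq> 0} \<le> 5" for x
      using code(3)[OF that(1)] that(2) by (cases "x = 0") simp_all
    have card: "card (fun_of_vec n ` C) * CARD('a) ^ (n - k) = CARD('a) ^ n"
      unfolding code(2) using k by (simp flip: power_add)
    obtain A where A: "A \<subseteq> coords (n - k)" "card A = n" "sidon A" "\<forall>x\<in>sols A. \<exists>a. \<forall>i<5. x i = a"
      using code_columns[OF code(1) card weight two \<alpha>(3)] by blast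
    have "(real n)\<^sup>2 < q powr (- M) * real (CARD('a) ^ (n - k))"
      using n0[OF A(1,3,4)] A(2) n by simp
    also have "real (CARD('a) ^ (n - k)) = q powr (real n - real k)"
      using powr_realpow[of q "n - k"] q k unfolding q_def by (simp add: of_nat_diff)
    also have "q powr (- M) * q powr (real n - real k) = q powr (real n - real k - M)"
      by (simp flip: powr_add)
    finally have "log q ((real n)\<^sup>2) < real n - real k - M"
      using n q by (simp add: log_less_iff)
    then show ?thesis
      using n q by (simp add: log_nat_power)
  qed
  then show ?thesis unfolding q_def by blast
qed

theorem theorem1p3:
  fixes q :: nat
  assumes "CARD('a) = q"
    and "\<exists>p m. prime (p::nat) \<and> odd p \<and> m \<ge> 1 \<and> q = p ^ m"
    and "q \<ge> 7"
  shows "\<exists>\<omega> :: nat \<Rightarrow> real. filterlim \<omega> at_top at_top \<and>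
    (\<forall>n k. \<forall>C :: 'a::{field,finite} vec set. linear_code n k 6 C \<longrightarrow>
       real k \<le> real n - 2 * log (real q) (real n) - \<omega> n)"
proof -
  \<comment> \<open>The minimum of \<open>R n\<close> serves as \<open>\<omega> n\<close>. Inserting
    \<open>real n\<close> keeps the set nonempty when no code of length \<open>n\<close> exists, and
    this element tends to infinity as well.\<close>
  define R where "R n = insert (real n) {real n - real k - 2 * log (real q) (real n) | k.
    \<exists>C :: 'a vec set. linear_code n k 6 C}" for n
  have fin: "finite (R n)" for n
  proof (rule finite_subset)
    show "R n \<subseteq> insert (real n) ((\<lambda>k. real n - real k - 2 * log (real q) (real n)) ` {..n})"
      unfolding R_def using linear_code_dim_le by blast
  qed simp
  show ?thesis
  proof (intro exI[of _ "\<lambda>n. Min (R n)"] conjI allI impI)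
    show "filterlim (\<lambda>n. Min (R n)) at_top at_top"
      unfolding filterlim_at_top
    proof
      fix M :: real
      obtain n0 where n0: "\<forall>n\<ge>n0. \<forall>k. \<forall>C :: 'a vec set. linear_code n k 6 C \<longrightarrow>
          M \<le> real n - real k - 2 * log (real q) (real n)"
        using linear_code_6_eventually[where 'a = 'a, of _ _ M] assms by blast
      \<comment> \<open>The bound \<open>n0\<close> handles the gaps of codes, and the ceiling of
        \<open>M\<close> handles the inserted element.\<close>
      have "M \<le> Min (R n)" if n: "n \<ge> max n0 (nat \<lceil>M\<rceil>)" for n
      proof (rule Min.boundedI[OF fin])
        fix x assume "x \<in> R n"
        then show "M \<le> x"
          using n n0 unfolding R_def by (auto simp: nat_le_iff ceiling_le_iff)
      qed (simp add: R_def)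
      then show "\<forall>\<^sub>F n in at_top. M \<le> Min (R n)"
        by (rule eventually_at_top_linorderI)
    qed
  next
    fix n k and C :: "'a vec set" assume "linear_code n k 6 C"
    then have "Min (R n) \<le> real n - real k - 2 * log (real q) (real n)"
      by (intro Min_le fin) (auto simp: R_def)
    then show "real k \<le> real n - 2 * log (real q) (real n) - Min (R n)" by linarith
  qed
qed

end
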